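(* The joint spectrum of the velocity operators $\hat{\boldsymbol v}=(\hat v_1,\hat v_2)$ is $$\Sigma(\hat{\boldsymbol v})=\begin{cases}E_1\cap E_2,&(a,b)\in\Delta_{(0,1)}\ (\text{i.e. } a,b>0,\ a+b<1),\\ E,&(a,b)\in\Delta_1\ (\text{i.e. } a,b>0,\ a+b=1),\end{cases}$$ where $E_j=\bigl\{\boldsymbol v\in\mathbb R^2:\frac{(v_1+v_2)^2}{4a_j^2}+\frac{(v_1-v_2)^2}{4b_j^2}\le1\bigr\}$ for $j=1,2$ and $E=\bigl\{\boldsymbol v\in\mathbb R^2:\frac{(v_1+v_2)^2}{4a}+\frac{(v_1-v_2)^2}{4b}\le1\bigr\}$.
   Context: Parameters: $a_1,a_2\in[0,1]$, $b_j=\sqrt{1-a_j^2}$, $a=a_1a_2$, $b=b_1b_2$. $\mathbb T=\mathbb R/2\pi\mathbb Z$; $C_j=\begin{pmatrix}a_j&b_j\\-b_j&a_j\end{pmatrix}$; $\hat U(\boldsymbol k)=D(k_2)C_2D(k_1)C_1$, $D(\kappa)=\mathrm{diag}(e^{i\kappa},e^{-i\kappa})$. For $\boldsymbol k=(k_1,k_2)\in\mathbb T^2$: $l_1=k_2+k_1$, $l_2=k_2-k_1$, $c_i=\cos l_i$, $s_i=\sin l_i$, $\tau=ac_1-bc_2$, $\omega=\arccos\tau$; $|\omega_\pm(\boldsymbol k)\rangle$ is an orthonormal eigenbasis of $\hat U(\boldsymbol k)$ for the eigenvalues $e^{\pm i\omega(\boldsymbol k)}$. $v_1=-\frac{as_1+bs_2}{\sqrt{1-\tau^2}}$,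 $v_2=-\frac{as_1-bs_2}{\sqrt{1-\tau^2}}$ (defined a.e., where $\tau^2\ne1$). The velocity operator $\hat v_j$ ($j=1,2$) is multiplication on $L^2(\mathbb T^2;\mathbb C^2)$ by the matrix $v_j(\boldsymbol k)|\omega_+(\boldsymbol k)\rangle\langle\omega_+(\boldsymbol k)|-v_j(\boldsymbol k)|\omega_-(\boldsymbol k)\rangle\langle\omega_-(\boldsymbol k)|$. $\hat v_1,\hat v_2$ are commuting bounded self-adjoint operators; $\Sigma(\hat{\boldsymbol v})$ is the support of their joint spectral measure, i.e. the closure of the union of the images of $\boldsymbol v=(v_1,v_2)$ and $-\boldsymbol v$. *)

theory Defs
  imports "HOL-Analysis.Analysis"
begin

section \<open>Vector-valued square-integrable functions\<close>

text \<open>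
  Elements of the Hilbert space \<open>L\<^sup>2(M; \<complex>\<^sup>n)\<close> are represented by functions, and equality in the
  space is equality almost everywhere.  The inner product is conjugate-linear in its first argument.
\<close>

definition cvec_inner :: "complex ^ 'n \<Rightarrow> complex ^ 'n \<Rightarrow> complex" where
  "cvec_inner x y = (\<Sum>i\<in>UNIV. cnj (x $ i) * y $ i)"

definition L2 :: "'a measure \<Rightarrow> ('a \<Rightarrow> complex ^ 'n) set" where
  "L2 M = {f \<in> borel_measurable M. integrable M (\<lambda>x. (norm (f x))\<^sup>2)}"

definition L2_eq :: "'a measure \<Rightarrow> ('a \<Rightarrow> complex ^ 'n) \<Rightarrow> ('a \<Rightarrow> complex ^ 'n) \<Rightarrow> bool" where
  "L2_eq M f g \<longleftrightarrow> (AE x in M. f x = g x)"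

definition L2_inner :: "'a measure \<Rightarrow> ('a \<Rightarrow> complex ^ 'n) \<Rightarrow> ('a \<Rightarrow> complex ^ 'n) \<Rightarrow> complex" where
  "L2_inner M f g = (\<integral>x. cvec_inner (f x) (g x) \<partial>M)"

definition L2_norm :: "'a measure \<Rightarrow> ('a \<Rightarrow> complex ^ 'n) \<Rightarrow> real" where
  "L2_norm M f = sqrt (\<integral>x. (norm (f x))\<^sup>2 \<partial>M)"

definition L2_operator ::
    "'a measure \<Rightarrow> (('a \<Rightarrow> complex ^ 'n) \<Rightarrow> ('a \<Rightarrow> complex ^ 'n)) \<Rightarrow> bool" where
  "L2_operator M T \<longleftrightarrow>
     (\<forall>f\<in>L2 M. T f \<in> L2 M) \<and>
     (\<forall>f\<in>L2 M. \<forall>g\<in>L2 M. L2_eq M f g \<longrightarrow> L2_eq M (T f) (T g)) \<and>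
     (\<forall>f\<in>L2 M. \<forall>g\<in>L2 M. L2_eq M (T (\<lambda>x. f x + g x)) (\<lambda>x. T f x + T g x)) \<and>
     (\<forall>c. \<forall>f\<in>L2 M. L2_eq M (T (\<lambda>x. c *s f x)) (\<lambda>x. c *s T f x)) \<and>
     (\<exists>C. \<forall>f\<in>L2 M. L2_norm M (T f) \<le> C * L2_norm M f)"

definition L2_orthogonal_projection ::
    "'a measure \<Rightarrow> (('a \<Rightarrow> complex ^ 'n) \<Rightarrow> ('a \<Rightarrow> complex ^ 'n)) \<Rightarrow> bool" where
  "L2_orthogonal_projection M T \<longleftrightarrow>
     L2_operator M T \<and>
     (\<forall>f\<in>L2 M. L2_eq M (T (T f)) (T f)) \<and>
     (\<forall>f\<in>L2 M. \<forall>g\<in>L2 M. L2_inner M (T f) g = L2_inner M f (T g))"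


section \<open>Joint spectral measures\<close>

text \<open>
  A projection-valued measure on the Borel sets of \<open>\<real>\<^sup>2\<close>; countable additivity holds in the strong
  operator topology.
\<close>

definition projection_valued_measure ::
    "'a measure \<Rightarrow> ((real \<times> real) set \<Rightarrow> ('a \<Rightarrow> complex ^ 'n) \<Rightarrow> ('a \<Rightarrow> complex ^ 'n)) \<Rightarrow> bool" where
  "projection_valued_measure M P \<longleftrightarrow>
     (\<forall>B\<in>sets borel. L2_orthogonal_projection M (P B)) \<and>
     (\<forall>f\<in>L2 M. L2_eq M (P UNIV f) f) \<and>
     (\<forall>A\<in>sets borel. \<forall>B\<in>sets borel. \<forall>f\<in>L2 M. L2_eq M (P (A \<inter> B) f) (P A (P B f))) \<and>
     (\<forall>A. range A \<subseteq> sets borel \<and> disjoint_family A \<longrightarrow>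
        (\<forall>f\<in>L2 M.
           (\<lambda>n::nat. L2_norm M (\<lambda>x. (\<Sum>i<n. P (A i) f x) - P (\<Union>i. A i) f x)) \<longlonglongrightarrow> 0))"

text \<open>The finite positive Borel measure \<open>B \<mapsto> \<langle>f, P(B) f\<rangle>\<close> on \<open>\<real>\<^sup>2\<close>.\<close>

definition scalar_spectral_measure ::
    "'a measure \<Rightarrow> ((real \<times> real) set \<Rightarrow> ('a \<Rightarrow> complex ^ 'n) \<Rightarrow> ('a \<Rightarrow> complex ^ 'n)) \<Rightarrow>
     ('a \<Rightarrow> complex ^ 'n) \<Rightarrow> (real \<times> real) measure" where
  "scalar_spectral_measure M P f =
     measure_of UNIV (sets borel) (\<lambda>B. ennreal (Re (L2_inner M f (P B f))))"

text \<open>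
  \<open>P\<close> is the joint spectral measure of \<open>T\<^sub>1\<close> and \<open>T\<^sub>2\<close> if \<open>T\<^sub>j = \<integral> x\<^sub>j dP(x)\<close> for \<open>j = 1, 2\<close>.  The two
  operator identities are expressed through their quadratic forms, which determine bounded
  operators on a complex Hilbert space by polarization.
\<close>

definition joint_spectral_measure ::
    "'a measure \<Rightarrow> (('a \<Rightarrow> complex ^ 'n) \<Rightarrow> ('a \<Rightarrow> complex ^ 'n)) \<Rightarrow>
     (('a \<Rightarrow> complex ^ 'n) \<Rightarrow> ('a \<Rightarrow> complex ^ 'n)) \<Rightarrow>
     ((real \<times> real) set \<Rightarrow> ('a \<Rightarrow> complex ^ 'n) \<Rightarrow> ('a \<Rightarrow> complex ^ 'n)) \<Rightarrow> bool" where
  "joint_spectral_measure M T1 T2 P \<longleftrightarrow>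
     projection_valued_measure M P \<and>
     (\<forall>f\<in>L2 M.
        integrable (scalar_spectral_measure M P f) fst \<and>
        L2_inner M f (T1 f) = of_real (\<integral>x. fst x \<partial>scalar_spectral_measure M P f) \<and>
        integrable (scalar_spectral_measure M P f) snd \<and>
        L2_inner M f (T2 f) = of_real (\<integral>x. snd x \<partial>scalar_spectral_measure M P f))"

definition pvm_support ::
    "'a measure \<Rightarrow> ((real \<times> real) set \<Rightarrow> ('a \<Rightarrow> complex ^ 'n) \<Rightarrow> ('a \<Rightarrow> complex ^ 'n)) \<Rightarrow>
     (real \<times> real) set" where
  "pvm_support M P =
     {x. \<forall>U. open U \<and> x \<in> U \<longrightarrow> (\<exists>f\<in>L2 M. \<not> L2_eq M (P U f) (\<lambda>_. 0))}"

text \<open>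
  For commuting bounded self-adjoint operators the joint spectral measure exists and is unique up to
  almost everywhere equality, so the choice below does not affect the support.
\<close>

definition joint_spectrum ::
    "'a measure \<Rightarrow> (('a \<Rightarrow> complex ^ 'n) \<Rightarrow> ('a \<Rightarrow> complex ^ 'n)) \<Rightarrow>
     (('a \<Rightarrow> complex ^ 'n) \<Rightarrow> ('a \<Rightarrow> complex ^ 'n)) \<Rightarrow> (real \<times> real) set" where
  "joint_spectrum M T1 T2 = pvm_support M (SOME P. joint_spectral_measure M T1 T2 P)"

definition multiplication_operator ::
    "('a \<Rightarrow> complex ^ 'n ^ 'n) \<Rightarrow> ('a \<Rightarrow> complex ^ 'n) \<Rightarrow> ('a \<Rightarrow> complex ^ 'n)" where
  "multiplication_operator A f = (\<lambda>x. A x *v f x)"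


section \<open>The quantum walk in momentum space\<close>

text \<open>The torus \<open>(\<real>/2\<pi>\<int>)\<^sup>2\<close> is represented by a fundamental domain.\<close>

definition torus :: "(real \<times> real) set" where
  "torus = {0..<2 * pi} \<times> {0..<2 * pi}"

abbreviation torus_measure :: "(real \<times> real) measure" where
  "torus_measure \<equiv> lebesgue_on torus"

definition co :: "real \<Rightarrow> real" where
  "co x = sqrt (1 - x\<^sup>2)"

definition coin :: "real \<Rightarrow> complex ^ 2 ^ 2" where
  "coin x = vector [vector [of_real x, of_real (co x)], vector [- of_real (co x), of_real x]]"

definition shift :: "real \<Rightarrow> complex ^ 2 ^ 2" where
  "shift \<kappa> = vector [vector [exp (\<i> * of_real \<kappa>), 0], vector [0, exp (- (\<i> * of_real \<kappa>))]]"

definition walk :: "real \<Rightarrow> real \<Rightarrow> real \<times> real \<Rightarrow> complex ^ 2 ^ 2" where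
  "walk a1 a2 k = shift (snd k) ** coin a2 ** shift (fst k) ** coin a1"

definition l1 :: "real \<times> real \<Rightarrow> real" where "l1 k = snd k + fst k"
definition l2 :: "real \<times> real \<Rightarrow> real" where "l2 k = snd k - fst k"

definition tau :: "real \<Rightarrow> real \<Rightarrow> real \<times> real \<Rightarrow> real" where
  "tau a1 a2 k = a1 * a2 * cos (l1 k) - co a1 * co a2 * cos (l2 k)"

definition omega :: "real \<Rightarrow> real \<Rightarrow> real \<times> real \<Rightarrow> real" where
  "omega a1 a2 k = arccos (tau a1 a2 k)"

text \<open>Where \<open>\<tau>\<^sup>2 = 1\<close> the velocities below take the irrelevant value \<open>0\<close>.\<close>

definition vel1 :: "real \<Rightarrow> real \<Rightarrow> real \<times> real \<Rightarrow> real" where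
  "vel1 a1 a2 k =
     - ((a1 * a2 * sin (l1 k) + co a1 * co a2 * sin (l2 k)) / sqrt (1 - (tau a1 a2 k)\<^sup>2))"

definition vel2 :: "real \<Rightarrow> real \<Rightarrow> real \<times> real \<Rightarrow> real" where
  "vel2 a1 a2 k =
     - ((a1 * a2 * sin (l1 k) - co a1 * co a2 * sin (l2 k)) / sqrt (1 - (tau a1 a2 k)\<^sup>2))"

definition walk_eigenbasis ::
    "real \<Rightarrow> real \<Rightarrow> real \<times> real \<Rightarrow> complex ^ 2 \<Rightarrow> complex ^ 2 \<Rightarrow> bool" where
  "walk_eigenbasis a1 a2 k wp wm \<longleftrightarrow>
     cvec_inner wp wp = 1 \<and> cvec_inner wm wm = 1 \<and> cvec_inner wp wm = 0 \<and>
     walk a1 a2 k *v wp = exp (\<i> * of_real (omega a1 a2 k)) *s wp \<and>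
     walk a1 a2 k *v wm = exp (- (\<i> * of_real (omega a1 a2 k))) *s wm"

text \<open>The matrix \<open>|w\<rangle>\<langle>w|\<close>.\<close>

definition ket_bra :: "complex ^ 'n \<Rightarrow> complex ^ 'n ^ 'n" where
  "ket_bra w = (\<chi> i j. w $ i * cnj (w $ j))"

definition velocity_operator ::
    "(real \<times> real \<Rightarrow> real) \<Rightarrow> (real \<times> real \<Rightarrow> complex ^ 2) \<Rightarrow> (real \<times> real \<Rightarrow> complex ^ 2) \<Rightarrow>
     (real \<times> real \<Rightarrow> complex ^ 2) \<Rightarrow> (real \<times> real \<Rightarrow> complex ^ 2)" where
  "velocity_operator v wp wm =
     multiplication_operator (\<lambda>k. v k *\<^sub>R ket_bra (wp k) - v k *\<^sub>R ket_bra (wm k))"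

definition ellipse :: "real \<Rightarrow> real \<Rightarrow> (real \<times> real) set" where
  "ellipse \<alpha> \<beta> = {(v1, v2). (v1 + v2)\<^sup>2 / (4 * \<alpha>) + (v1 - v2)\<^sup>2 / (4 * \<beta>) \<le> 1}"

end

theory Submission
  imports Defs
begin

text \<open>
  For any joint spectral measure \<open>P\<close>, a point \<open>c\<close> lies in the support exactly if there are joint
  approximate eigenvectors for \<open>c\<close>: a vector in the range of \<open>P(U)\<close>, with \<open>U\<close> a small ball around
  \<open>c\<close>, is one, and conversely an approximate eigenvector has little mass in each of the four half
  planes that cover the complement of a square around \<open>c\<close>.  This makes uniqueness of \<open>P\<close>
  unnecessary.  A velocity operator acts at \<open>k\<close> as \<open>v\<^sub>j(k) (Q(k) - (1 - Q(k)))\<close>, where the projection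
  \<open>Q(k)\<close> onto the eigenspace of \<open>e\<^sup>i\<^sup>\<omega>\<close> is the measurable function \<open>(1 + (U - \<tau>) / (i sin \<omega>)) / 2\<close> of
  \<open>k\<close>, even if the given eigenvectors are not measurable.  Hence the joint approximate eigenvalues
  form the closure of the image of \<open>v\<close>, which is symmetric because \<open>v\<close> is odd in \<open>(l\<^sub>1, l\<^sub>2)\<close>.  The image
  lies in both ellipses by the Cauchy-Schwarz inequality, and a preimage of a given point is found by
  solving a quadratic equation for \<open>\<tau>\<^sup>2\<close>.
\<close>


section \<open>The real inner product of L2\<close>

text \<open>The obstacle is that \<open>joint_spectral_measure\<close> fixes first moments only: the
  quadratic form of each operator is the mean of a coordinate. The norm of \<open>T f - c f\<close>
  belongs to a second moment and is not directly available. Polarization bridges the gap twice: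
  additivity of scalar measures shows that the operators respect the ranges of the
  \<open>P B\<close>, and a bound for the form of \<open>T - c\<close> on such a range is turned
  into a norm bound. Both cases of the theorem are one identity. With
  \<open>a1 = cos \<theta>\<close> and \<open>a2 = cos \<theta>'\<close> one has
  \<open>a + b = cos (\<theta> - \<theta>')\<close>, so for positive \<open>a\<close>,
  \<open>b\<close> the case \<open>a + b = 1\<close> means \<open>a1 = a2\<close>, and then both
  ellipses are the ellipse for \<open>a\<close>, \<open>b\<close>. In that case the preimage
  construction degenerates on the boundary curve, whose points are therefore obtained as limits of
  interior ones.\<close>

lemma inner_eq_Re_cvec_inner: "x \<bullet> y = Re (cvec_inner x y)"
  by (simp add: cvec_inner_def inner_vec_def inner_complex_def)

lemma cvec_inner_self: "cvec_inner x x = of_real ((norm x)\<^sup>2)"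
proof (rule complex_eqI)
  show "Re (cvec_inner x x) = Re (of_real ((norm x)\<^sup>2))"
    by (simp add: inner_eq_Re_cvec_inner[symmetric] power2_norm_eq_inner)
  show "Im (cvec_inner x x) = Im (of_real ((norm x)\<^sup>2))"
    by (simp add: cvec_inner_def mult.commute)
qed

lemma norm_cvec_inner_le: "norm (cvec_inner x (y :: complex ^ 'n)) \<le> real CARD('n) * (norm x * norm y)"
proof -
  have "norm (cvec_inner x y) \<le> (\<Sum>i\<in>UNIV. norm (cnj (x $ i) * y $ i))"
    unfolding cvec_inner_def by (rule norm_sum)
  also have "\<dots> \<le> (\<Sum>i\<in>(UNIV :: 'n set). norm x * norm y)"
    by (intro sum_mono) (auto simp: norm_mult intro!: mult_mono Finite_Cartesian_Product.norm_nth_le)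
  finally show ?thesis by simp
qed

lemma of_real_vector_smult: "complex_of_real c *s x = c *\<^sub>R x"
  by (simp add: vec_eq_iff) (simp add: scaleR_conv_of_real)

text \<open>The space regarded as a real Hilbert space. Norms and the forms of symmetric operators
  are determined by real parts, so the abstract spectral arguments can run over the reals.\<close>

definition L2_rinner :: "'a measure \<Rightarrow> ('a \<Rightarrow> complex ^ 'n) \<Rightarrow> ('a \<Rightarrow> complex ^ 'n) \<Rightarrow> real" where
  "L2_rinner M f g = (\<integral>x. f x \<bullet> g x \<partial>M)"

lemma L2_D:
  assumes "f \<in> L2 M"
  shows "f \<in> borel_measurable M" "integrable M (\<lambda>x. (norm (f x))\<^sup>2)"
  using assms by (auto simp: L2_def)

lemma L2_bounded:
  assumes "g \<in> borel_measurable M" "f \<in> L2 M" "\<And>x. x \<in> space M \<Longrightarrow> norm (g x) \<le> C * norm (f x)"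
  shows "g \<in> L2 M"
proof -
  have "(norm (g x))\<^sup>2 \<le> C\<^sup>2 * (norm (f x))\<^sup>2" if "x \<in> space M" for x
    using power_mono[OF assms(3)[OF that], of 2] by (simp add: power_mult_distrib)
  moreover have "integrable M (\<lambda>x. C\<^sup>2 * (norm (f x))\<^sup>2)"
    using L2_D(2)[OF assms(2)] by simp
  ultimately have "integrable M (\<lambda>x. (norm (g x))\<^sup>2)"
    using assms(1) by (elim Bochner_Integration.integrable_bound) auto
  thus ?thesis using assms(1) by (simp add: L2_def)
qed

lemma L2_add [intro]:
  assumes "f \<in> L2 M" "g \<in> L2 M" shows "(\<lambda>x. f x + g x) \<in> L2 M"
proof -
  have m [measurable]: "f \<in> borel_measurable M" "g \<in> borel_measurable M"
    using assms by (auto dest: L2_D)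
  have *: "(norm (u + w))\<^sup>2 \<le> 2 * (norm u)\<^sup>2 + 2 * (norm w)\<^sup>2" for u w :: "complex ^ 'n"
    using power_mono[OF norm_triangle_ineq[of u w], of 2] sum_squares_bound[of "norm u" "norm w"]
    by (simp add: power2_sum)
  have "integrable M (\<lambda>x. 2 * (norm (f x))\<^sup>2 + 2 * (norm (g x))\<^sup>2)"
    using assms by (simp add: L2_D(2))
  hence "integrable M (\<lambda>x. (norm (f x + g x))\<^sup>2)"
    using * by (elim Bochner_Integration.integrable_bound) auto
  thus ?thesis by (simp add: L2_def)
qed

lemma L2_scaleR [intro]: "f \<in> L2 M \<Longrightarrow> (\<lambda>x. c *\<^sub>R f x) \<in> L2 M"
  by (rule L2_bounded[where C = "\<bar>c\<bar>"]) (auto dest: L2_D(1))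

lemma L2_uminus [intro]: "f \<in> L2 M \<Longrightarrow> (\<lambda>x. - f x) \<in> L2 M"
  using L2_scaleR[of f M "-1"] by simp

lemma L2_diff [intro]: "f \<in> L2 M \<Longrightarrow> g \<in> L2 M \<Longrightarrow> (\<lambda>x. f x - g x) \<in> L2 M"
  using L2_add[of f M "\<lambda>x. (-1) *\<^sub>R g x"] L2_scaleR[of g M "-1"] by simp

lemma L2_zero [simp]: "(\<lambda>_. 0) \<in> L2 M"
  by (simp add: L2_def)

lemma L2_sum [intro]:
  "finite I \<Longrightarrow> (\<And>i. i \<in> I \<Longrightarrow> f i \<in> L2 M) \<Longrightarrow> (\<lambda>x. \<Sum>i\<in>I. f i x) \<in> L2 M"
  by (induction I rule: finite_induct) auto

lemma integrable_norm_mult: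
  assumes "f \<in> L2 M" "g \<in> L2 M"
  shows "integrable M (\<lambda>x. norm (f x) * norm (g x))"
proof -
  have m [measurable]: "f \<in> borel_measurable M" "g \<in> borel_measurable M"
    using assms by (auto dest: L2_D)
  have *: "integrable M (\<lambda>x. (norm (f x))\<^sup>2 + (norm (g x))\<^sup>2)"
    using assms by (auto dest: L2_D)
  show ?thesis
  proof (rule Bochner_Integration.integrable_bound[OF *])
    show "AE x in M. norm (norm (f x) * norm (g x)) \<le> norm ((norm (f x))\<^sup>2 + (norm (g x))\<^sup>2)"
    proof (rule AE_I2)
      fix x
      have "0 \<le> norm (f x) * norm (g x)" by simp
      thus "norm (norm (f x) * norm (g x)) \<le> norm ((norm (f x))\<^sup>2 + (norm (g x))\<^sup>2)"
        using sum_squares_bound[of "norm (f x)" "norm (g x)"] unfolding real_norm_def by linarith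
    qed
  qed measurable
qed

lemma integrable_inner:
  assumes "f \<in> L2 M" "g \<in> L2 M"
  shows "integrable M (\<lambda>x. f x \<bullet> g x)"
proof (rule Bochner_Integration.integrable_bound[OF integrable_norm_mult[OF assms]])
  show "(\<lambda>x. f x \<bullet> g x) \<in> borel_measurable M"
    using assms by (auto dest!: L2_D(1) intro: borel_measurable_inner)
  show "AE x in M. norm (f x \<bullet> g x) \<le> norm (norm (f x) * norm (g x))"
    by (auto simp: Cauchy_Schwarz_ineq2)
qed

lemma borel_measurable_cvec_inner:
  assumes "f \<in> borel_measurable M" "g \<in> borel_measurable M"
  shows "(\<lambda>x. cvec_inner (f x) (g x)) \<in> borel_measurable M"
proof -
  have "continuous_on UNIV (\<lambda>p :: (complex ^ 'n) \<times> (complex ^ 'n). cvec_inner (fst p) (snd p))"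
    unfolding cvec_inner_def by (intro continuous_intros)
  from borel_measurable_continuous_Pair[OF assms this] show ?thesis by simp
qed

lemma integrable_cvec_inner:
  fixes f g :: "'a \<Rightarrow> complex ^ 'n"
  assumes "f \<in> L2 M" "g \<in> L2 M"
  shows "integrable M (\<lambda>x. cvec_inner (f x) (g x))"
proof (rule Bochner_Integration.integrable_bound)
  show "integrable M (\<lambda>x. real CARD('n) * (norm (f x) * norm (g x)))"
    using integrable_norm_mult[OF assms] by simp
  show "(\<lambda>x. cvec_inner (f x) (g x)) \<in> borel_measurable M"
    using assms by (auto dest!: L2_D(1) intro: borel_measurable_cvec_inner)
  show "AE x in M. norm (cvec_inner (f x) (g x)) \<le> norm (real CARD('n) * (norm (f x) * norm (g x)))"
    using norm_cvec_inner_le by (auto simp: abs_mult)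
qed

lemma Re_L2_inner:
  assumes "f \<in> L2 M" "g \<in> L2 M"
  shows "Re (L2_inner M f g) = L2_rinner M f g"
  using integrable_cvec_inner[OF assms]
  by (simp add: L2_inner_def L2_rinner_def inner_eq_Re_cvec_inner)

lemma L2_rinner_add:
  assumes "f \<in> L2 M" "g \<in> L2 M" "h \<in> L2 M"
  shows "L2_rinner M (\<lambda>x. f x + g x) h = L2_rinner M f h + L2_rinner M g h"
    and "L2_rinner M h (\<lambda>x. f x + g x) = L2_rinner M h f + L2_rinner M h g"
  using assms by (simp_all add: L2_rinner_def inner_add integrable_inner)

lemma L2_rinner_diff:
  assumes "f \<in> L2 M" "g \<in> L2 M" "h \<in> L2 M"
  shows "L2_rinner M (\<lambda>x. f x - g x) h = L2_rinner M f h - L2_rinner M g h"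
    and "L2_rinner M h (\<lambda>x. f x - g x) = L2_rinner M h f - L2_rinner M h g"
  using assms by (simp_all add: L2_rinner_def inner_diff integrable_inner)

lemma L2_rinner_scaleR:
  shows "L2_rinner M (\<lambda>x. c *\<^sub>R f x) h = c * L2_rinner M f h"
    and "L2_rinner M h (\<lambda>x. c *\<^sub>R f x) = c * L2_rinner M h f"
  by (simp_all add: L2_rinner_def)

lemma L2_rinner_zero [simp]: "L2_rinner M (\<lambda>_. 0) f = 0" "L2_rinner M f (\<lambda>_. 0) = 0"
  by (simp_all add: L2_rinner_def)

lemma L2_rinner_sum:
  assumes "finite I" "\<And>i. i \<in> I \<Longrightarrow> f i \<in> L2 M" "h \<in> L2 M"
  shows "L2_rinner M h (\<lambda>x. \<Sum>i\<in>I. f i x) = (\<Sum>i\<in>I. L2_rinner M h (f i))"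
  using assms by (simp add: L2_rinner_def inner_sum_right integrable_inner)

lemma L2_rinner_commute: "L2_rinner M f g = L2_rinner M g f"
  by (simp add: L2_rinner_def inner_commute)

lemma L2_rinner_self: "L2_rinner M f f = (L2_norm M f)\<^sup>2"
  by (simp add: L2_rinner_def L2_norm_def power2_norm_eq_inner[symmetric])

lemma L2_norm_nonneg [simp]: "0 \<le> L2_norm M f"
  by (simp add: L2_norm_def)

lemma L2_norm_eq_0_iff:
  assumes "f \<in> L2 M"
  shows "L2_norm M f = 0 \<longleftrightarrow> L2_eq M f (\<lambda>_. 0)"
  using integral_nonneg_eq_0_iff_AE[OF L2_D(2)[OF assms]]
  by (simp add: L2_norm_def L2_eq_def)

lemma L2_eq_refl [simp]: "L2_eq M f f"
  by (simp add: L2_eq_def)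

lemma L2_eq_sym: "L2_eq M f g \<Longrightarrow> L2_eq M g f"
  by (auto simp: L2_eq_def)

lemma L2_rinner_cong:
  assumes "L2_eq M f f'" "L2_eq M g g'" "f \<in> L2 M" "f' \<in> L2 M" "g \<in> L2 M" "g' \<in> L2 M"
  shows "L2_rinner M f g = L2_rinner M f' g'"
  unfolding L2_rinner_def
proof (rule integral_cong_AE)
  show "AE x in M. f x \<bullet> g x = f' x \<bullet> g' x"
    using assms(1,2) unfolding L2_eq_def by eventually_elim auto
qed (use assms in \<open>auto intro: borel_measurable_integrable integrable_inner\<close>)

lemma L2_norm_cong:
  assumes "L2_eq M f g" "f \<in> L2 M" "g \<in> L2 M"
  shows "L2_norm M f = L2_norm M g"
  using L2_rinner_cong[OF assms(1,1)] assms(2,3) by (simp add: L2_rinner_self)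

lemma L2_Cauchy_Schwarz:
  assumes f: "f \<in> L2 M" and g: "g \<in> L2 M"
  shows "L2_rinner M f g \<le> L2_norm M f * L2_norm M g"
proof (cases "L2_norm M f = 0 \<or> L2_norm M g = 0")
  case True
  hence "L2_rinner M f g = 0"
    using L2_rinner_cong[of M f "\<lambda>_. 0" g g] L2_rinner_cong[of M f f g "\<lambda>_. 0"] f g
    by (auto simp: L2_norm_eq_0_iff)
  with True show ?thesis by auto
next
  case False
  let ?s = "L2_norm M f" and ?t = "L2_norm M g"
  have pos: "?s > 0" "?t > 0" using False L2_norm_nonneg[of M] by (metis less_le)+
  \<comment> \<open>The weights give both terms the same norm; the square of the norm of
    \<open>?h\<close> is \<open>2 s t\<close> times the gap in the inequality.\<close>
  let ?h = "\<lambda>x. ?t *\<^sub>R f x - ?s *\<^sub>R g x"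
  have "0 \<le> L2_rinner M ?h ?h" by (simp add: L2_rinner_self)
  also have "L2_rinner M ?h ?h = 2 * ?s\<^sup>2 * ?t\<^sup>2 - 2 * ?s * ?t * L2_rinner M f g"
    using f g by (simp add: L2_rinner_diff L2_rinner_scaleR L2_diff L2_scaleR L2_rinner_self[of M f] L2_rinner_self[of M g]
        L2_rinner_commute[of M g f] algebra_simps power2_eq_square)
  finally have "?s * ?t * L2_rinner M f g \<le> ?s * ?t * (?s * ?t)"
    by (simp add: power2_eq_square algebra_simps)
  with pos show ?thesis by simp
qed

lemma L2_norm_minus: "L2_norm M (\<lambda>x. - f x) = L2_norm M f"
  by (simp add: L2_norm_def)

lemma abs_L2_rinner_le:
  assumes f: "f \<in> L2 M" and g: "g \<in> L2 M"
  shows "\<bar>L2_rinner M f g\<bar> \<le> L2_norm M f * L2_norm M g"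
proof -
  have "- L2_rinner M f g = L2_rinner M f (\<lambda>x. (-1) *\<^sub>R g x)"
    by (simp add: L2_rinner_def)
  also have "\<dots> \<le> L2_norm M f * L2_norm M (\<lambda>x. (-1) *\<^sub>R g x)"
    using f g by (intro L2_Cauchy_Schwarz) auto
  finally show ?thesis
    using L2_Cauchy_Schwarz[OF f g] by (simp add: L2_norm_minus)
qed

section \<open>Operators and projections\<close>

lemma L2_operatorD:
  assumes "L2_operator M T"
  shows "f \<in> L2 M \<Longrightarrow> T f \<in> L2 M"
    and "f \<in> L2 M \<Longrightarrow> g \<in> L2 M \<Longrightarrow> L2_eq M f g \<Longrightarrow> L2_eq M (T f) (T g)"
    and "f \<in> L2 M \<Longrightarrow> g \<in> L2 M \<Longrightarrow> L2_eq M (T (\<lambda>x. f x + g x)) (\<lambda>x. T f x + T g x)"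
    and "f \<in> L2 M \<Longrightarrow> L2_eq M (T (\<lambda>x. c *\<^sub>R f x)) (\<lambda>x. c *\<^sub>R T f x)"
proof -
  show "f \<in> L2 M \<Longrightarrow> T f \<in> L2 M"
    "f \<in> L2 M \<Longrightarrow> g \<in> L2 M \<Longrightarrow> L2_eq M f g \<Longrightarrow> L2_eq M (T f) (T g)"
    "f \<in> L2 M \<Longrightarrow> g \<in> L2 M \<Longrightarrow> L2_eq M (T (\<lambda>x. f x + g x)) (\<lambda>x. T f x + T g x)"
    using assms by (simp_all add: L2_operator_def)
  assume "f \<in> L2 M"
  hence "L2_eq M (T (\<lambda>x. complex_of_real c *s f x)) (\<lambda>x. complex_of_real c *s T f x)"
    using assms by (simp add: L2_operator_def)
  thus "L2_eq M (T (\<lambda>x. c *\<^sub>R f x)) (\<lambda>x. c *\<^sub>R T f x)"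
    by (simp only: of_real_vector_smult)
qed

lemma L2_operator_diff:
  assumes T: "L2_operator M T" and "f \<in> L2 M" "g \<in> L2 M"
  shows "L2_eq M (T (\<lambda>x. f x - g x)) (\<lambda>x. T f x - T g x)"
proof -
  have "L2_eq M (T (\<lambda>x. f x + (-1) *\<^sub>R g x)) (\<lambda>x. T f x + T (\<lambda>x. (-1) *\<^sub>R g x) x)"
    using assms by (intro L2_operatorD(3)[OF T]) auto
  moreover have "L2_eq M (T (\<lambda>x. (-1) *\<^sub>R g x)) (\<lambda>x. (-1) *\<^sub>R T g x)"
    using assms by (intro L2_operatorD(4)[OF T]) auto
  ultimately show ?thesis
    unfolding L2_eq_def by eventually_elim simp
qed

lemma L2_operator_zero:
  assumes T: "L2_operator M T"
  shows "L2_eq M (T (\<lambda>_. 0)) (\<lambda>_. 0)"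
  using L2_operatorD(4)[OF T L2_zero, of 0] by simp

lemma L2_rinner_operator:
  assumes T: "L2_operator M T" and L: "f \<in> L2 M" "g \<in> L2 M" "h \<in> L2 M"
  shows "L2_rinner M h (T (\<lambda>x. f x + g x)) = L2_rinner M h (T f) + L2_rinner M h (T g)"
    and "L2_rinner M h (T (\<lambda>x. f x - g x)) = L2_rinner M h (T f) - L2_rinner M h (T g)"
    and "L2_rinner M h (T (\<lambda>x. c *\<^sub>R f x)) = c * L2_rinner M h (T f)"
proof -
  note [intro] = L2_operatorD(1)[OF T]
  have "L2_rinner M h (T (\<lambda>x. f x + g x)) = L2_rinner M h (\<lambda>x. T f x + T g x)"
    using L by (intro L2_rinner_cong L2_operatorD(3)[OF T]) auto
  thus "L2_rinner M h (T (\<lambda>x. f x + g x)) = L2_rinner M h (T f) + L2_rinner M h (T g)"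
    using L by (simp add: L2_rinner_add L2_operatorD(1)[OF T])
  have "L2_rinner M h (T (\<lambda>x. f x - g x)) = L2_rinner M h (\<lambda>x. T f x - T g x)"
    using L by (intro L2_rinner_cong L2_operator_diff[OF T]) auto
  thus "L2_rinner M h (T (\<lambda>x. f x - g x)) = L2_rinner M h (T f) - L2_rinner M h (T g)"
    using L by (simp add: L2_rinner_diff L2_operatorD(1)[OF T])
  have "L2_rinner M h (T (\<lambda>x. c *\<^sub>R f x)) = L2_rinner M h (\<lambda>x. c *\<^sub>R T f x)"
    using L by (intro L2_rinner_cong L2_operatorD(4)[OF T]) auto
  thus "L2_rinner M h (T (\<lambda>x. c *\<^sub>R f x)) = c * L2_rinner M h (T f)"
    by (simp add: L2_rinner_scaleR)
qed

lemma L2_orthogonal_projectionD: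
  assumes "L2_orthogonal_projection M Q"
  shows "L2_operator M Q"
    and "f \<in> L2 M \<Longrightarrow> L2_eq M (Q (Q f)) (Q f)"
    and "f \<in> L2 M \<Longrightarrow> g \<in> L2 M \<Longrightarrow> L2_rinner M (Q f) g = L2_rinner M f (Q g)"
proof -
  show Q: "L2_operator M Q" using assms by (simp add: L2_orthogonal_projection_def)
  show "f \<in> L2 M \<Longrightarrow> L2_eq M (Q (Q f)) (Q f)"
    using assms by (simp add: L2_orthogonal_projection_def)
  assume "f \<in> L2 M" "g \<in> L2 M"
  thus "L2_rinner M (Q f) g = L2_rinner M f (Q g)"
    using assms L2_operatorD(1)[OF Q]
    by (simp add: L2_orthogonal_projection_def flip: Re_L2_inner)
qed

lemma L2_rinner_projection_self:
  assumes "L2_orthogonal_projection M Q" "f \<in> L2 M"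
  shows "L2_rinner M f (Q f) = (L2_norm M (Q f))\<^sup>2"
proof -
  note Q = L2_orthogonal_projectionD[OF assms(1)]
  note L = L2_operatorD(1)[OF Q(1)]
  have "(L2_norm M (Q f))\<^sup>2 = L2_rinner M f (Q (Q f))"
    using assms(2) by (simp add: L Q(3) flip: L2_rinner_self)
  also have "\<dots> = L2_rinner M f (Q f)"
    using assms(2) by (intro L2_rinner_cong Q(2)) (auto intro: L)
  finally show ?thesis by simp
qed


section \<open>Scalar spectral measures\<close>

lemma projection_valued_measureD:
  assumes "projection_valued_measure M P"
  shows "B \<in> sets borel \<Longrightarrow> L2_orthogonal_projection M (P B)"
    and "f \<in> L2 M \<Longrightarrow> L2_eq M (P UNIV f) f"
    and "A \<in> sets borel \<Longrightarrow> B \<in> sets borel \<Longrightarrow> f \<in> L2 M \<Longrightarrow> L2_eq M (P (A \<inter> B) f) (P A (P B f))"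
    and "range C \<subseteq> sets borel \<Longrightarrow> disjoint_family C \<Longrightarrow> f \<in> L2 M \<Longrightarrow>
       (\<lambda>n::nat. L2_norm M (\<lambda>x. (\<Sum>i<n. P (C i) f x) - P (\<Union>i. C i) f x)) \<longlonglongrightarrow> 0"
  using assms by (simp_all add: projection_valued_measure_def)

lemma pvm_operator:
  assumes "projection_valued_measure M P" "B \<in> sets borel"
  shows "L2_operator M (P B)"
  using L2_orthogonal_projectionD(1) projection_valued_measureD(1)[OF assms] by blast

lemma pvm_L2:
  assumes "projection_valued_measure M P" "B \<in> sets borel" "f \<in> L2 M"
  shows "P B f \<in> L2 M"
  using L2_operatorD(1)[OF pvm_operator[OF assms(1,2)]] assms(3) .

text \<open>Strong convergence implies weak convergence: by Cauchy-Schwarz the error of a partial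
  sum is at most the norm of \<open>f\<close> times the norm of the remainder.\<close>

lemma pvm_rinner_sums:
  fixes A :: "nat \<Rightarrow> (real \<times> real) set"
  assumes P: "projection_valued_measure M P" and f: "f \<in> L2 M"
    and A: "range A \<subseteq> sets borel" "disjoint_family A"
  shows "(\<lambda>i. L2_rinner M f (P (A i) f)) sums L2_rinner M f (P (\<Union>i. A i) f)"
proof -
  have Ai: "A i \<in> sets borel" for i using A(1) by blast
  have U: "(\<Union>i. A i) \<in> sets borel" using Ai by blast
  note L = pvm_L2[OF P Ai f] pvm_L2[OF P U f]
  have *: "norm ((\<Sum>i<n. L2_rinner M f (P (A i) f)) - L2_rinner M f (P (\<Union>i. A i) f))
      \<le> L2_norm M f * L2_norm M (\<lambda>x. (\<Sum>i<n. P (A i) f x) - P (\<Union>i. A i) f x)" for n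
  proof -
    have "(\<Sum>i<n. L2_rinner M f (P (A i) f)) - L2_rinner M f (P (\<Union>i. A i) f) =
        L2_rinner M f (\<lambda>x. (\<Sum>i<n. P (A i) f x) - P (\<Union>i. A i) f x)"
      using L f by (simp add: L2_rinner_diff L2_rinner_sum L2_sum)
    moreover have "(\<lambda>x. (\<Sum>i<n. P (A i) f x) - P (\<Union>i. A i) f x) \<in> L2 M"
      using L by (intro L2_diff L2_sum) auto
    ultimately show ?thesis using abs_L2_rinner_le[OF f] by simp
  qed
  have "(\<lambda>n. L2_norm M f * L2_norm M (\<lambda>x. (\<Sum>i<n. P (A i) f x) - P (\<Union>i. A i) f x)) \<longlonglongrightarrow> L2_norm M f * 0"
    by (intro tendsto_mult tendsto_const projection_valued_measureD(4)[OF P A f])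
  hence "(\<lambda>n. (\<Sum>i<n. L2_rinner M f (P (A i) f)) - L2_rinner M f (P (\<Union>i. A i) f)) \<longlonglongrightarrow> 0"
    unfolding mult_zero_right by (rule Lim_null_comparison[OF always_eventually[OF allI[OF *]]])
  thus ?thesis unfolding sums_def by (simp add: LIM_zero_iff)
qed

lemma pvm_rinner_eq_norm:
  assumes "projection_valued_measure M P" "B \<in> sets borel" "f \<in> L2 M"
  shows "L2_rinner M f (P B f) = (L2_norm M (P B f))\<^sup>2"
  using L2_rinner_projection_self projection_valued_measureD(1) assms by blast

lemma sets_scalar_spectral_measure [measurable_cong, simp]:
  "sets (scalar_spectral_measure M P f) = sets borel"
  by (simp add: scalar_spectral_measure_def sets_measure_of_conv sets.sigma_sets_eq[of borel, simplified])

lemma space_scalar_spectral_measure [simp]: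
  "space (scalar_spectral_measure M P f) = UNIV"
  by (simp add: scalar_spectral_measure_def space_measure_of_conv)

text \<open>\<open>measure_of\<close> has the intended values only for a positive and countably
  additive set function; both properties are checked here.\<close>

lemma emeasure_scalar_spectral_measure:
  assumes P: "projection_valued_measure M P" and f: "f \<in> L2 M" and B: "B \<in> sets borel"
  shows "emeasure (scalar_spectral_measure M P f) B = ennreal (L2_rinner M f (P B f))"
proof -
  let ?m = "\<lambda>B. L2_rinner M f (P B f)"
  have eq: "Re (L2_inner M f (P B f)) = ?m B" if "B \<in> sets borel" for B
    using Re_L2_inner[OF f pvm_L2[OF P that f]] .
  have nonneg: "0 \<le> ?m B" if "B \<in> sets borel" for B
    using pvm_rinner_eq_norm[OF P that f] by simp
  \<comment> \<open>\<open>P {}\<close> is not zero by definition. A disjoint sequence of empty sets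
    gives a convergent series with constant terms, so the constant is 0.\<close>
  have empty: "?m {} = 0"
  proof -
    have "(\<lambda>i::nat. ?m {}) sums ?m (\<Union>i::nat. {})"
      using pvm_rinner_sums[OF P f, of "\<lambda>_. {}"] by (simp add: disjoint_family_on_def)
    from summable_LIMSEQ_zero[OF sums_summable[OF this]] show ?thesis
      by (simp add: LIMSEQ_const_iff)
  qed
  have "emeasure (scalar_spectral_measure M P f) B = ennreal (Re (L2_inner M f (P B f)))"
    unfolding scalar_spectral_measure_def
  proof (rule emeasure_measure_of_sigma)
    show "sigma_algebra UNIV (sets (borel :: (real \<times> real) measure))"
      using sets.sigma_algebra_axioms[of "borel :: (real \<times> real) measure"] by simp
    show "positive (sets borel) (\<lambda>B. ennreal (Re (L2_inner M f (P B f))))"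
      using eq empty by (simp add: positive_def)
    show "countably_additive (sets borel) (\<lambda>B. ennreal (Re (L2_inner M f (P B f))))"
    proof (rule countably_additiveI)
      fix A :: "nat \<Rightarrow> (real \<times> real) set"
      assume A: "range A \<subseteq> sets borel" "disjoint_family A" "(\<Union>i. A i) \<in> sets borel"
      have Ai: "A i \<in> sets borel" for i using A(1) by blast
      have "(\<Sum>i. ennreal (?m (A i))) = ennreal (?m (\<Union>i. A i))"
        by (intro suminf_ennreal_eq nonneg Ai pvm_rinner_sums[OF P f A(1,2)])
      thus "(\<Sum>i. ennreal (Re (L2_inner M f (P (A i) f)))) = ennreal (Re (L2_inner M f (P (\<Union>i. A i) f)))"
        using eq Ai A(3) by simp
    qed
  qed (fact B)
  with eq B show ?thesis by simp
qed

lemma emeasure_scalar_spectral_measure_norm: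
  assumes "projection_valued_measure M P" "f \<in> L2 M" "B \<in> sets borel"
  shows "emeasure (scalar_spectral_measure M P f) B = ennreal ((L2_norm M (P B f))\<^sup>2)"
  using emeasure_scalar_spectral_measure[OF assms] pvm_rinner_eq_norm assms by metis

lemma emeasure_scalar_spectral_measure_UNIV:
  assumes P: "projection_valued_measure M P" and f: "f \<in> L2 M"
  shows "emeasure (scalar_spectral_measure M P f) UNIV = ennreal ((L2_norm M f)\<^sup>2)"
proof -
  have "L2_norm M (P UNIV f) = L2_norm M f"
    by (intro L2_norm_cong projection_valued_measureD(2)[OF P] pvm_L2[OF P] f) auto
  thus ?thesis using emeasure_scalar_spectral_measure_norm[OF P f, of UNIV] by simp
qed

lemma finite_scalar_spectral_measure:
  assumes "projection_valued_measure M P" "f \<in> L2 M"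
  shows "finite_measure (scalar_spectral_measure M P f)"
  by (rule finite_measureI) (simp add: emeasure_scalar_spectral_measure_UNIV[OF assms])

text \<open>\<open>B\<close> and \<open>UNIV\<close> have the same finite mass, the squared norm of
  \<open>f\<close>, so the complement of \<open>B\<close> is a null set.\<close>

lemma AE_scalar_spectral_measure:
  assumes P: "projection_valued_measure M P" and f: "f \<in> L2 M" and B: "B \<in> sets borel"
    and fix_f: "L2_eq M (P B f) f"
  shows "AE x in scalar_spectral_measure M P f. x \<in> B"
proof -
  interpret finite_measure "scalar_spectral_measure M P f"
    by (rule finite_scalar_spectral_measure[OF P f])
  have "L2_norm M (P B f) = L2_norm M f"
    by (intro L2_norm_cong fix_f pvm_L2[OF P B f] f)
  hence "emeasure (scalar_spectral_measure M P f) (UNIV - B) = 0"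
    using emeasure_Diff[of "scalar_spectral_measure M P f" B UNIV] B
      emeasure_scalar_spectral_measure_UNIV[OF P f] emeasure_scalar_spectral_measure_norm[OF P f B]
    by simp
  thus ?thesis
    using B by (intro AE_I[where N = "UNIV - B"]) auto
qed

text \<open>Induction over measurable functions. The hypothesis compares three given measures, as
  they arise for \<open>f\<close>, \<open>g\<close> and \<open>f + g\<close>, and again when a
  scalar measure is split into the parts for \<open>v\<close> and \<open>- v\<close>.\<close>

lemma nn_integral_sum_measure:
  assumes s: "sets N1 = sets N" "sets N2 = sets N"
    and e: "\<And>A. A \<in> sets N \<Longrightarrow> emeasure N A = emeasure N1 A + emeasure N2 A"
    and g: "g \<in> borel_measurable N"
  shows "(\<integral>\<^sup>+x. g x \<partial>N) = (\<integral>\<^sup>+x. g x \<partial>N1) + (\<integral>\<^sup>+x. g x \<partial>N2)"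
proof -
  note sp = sets_eq_imp_space_eq[OF s(1)] sets_eq_imp_space_eq[OF s(2)]
  have m: "h \<in> borel_measurable N1" "h \<in> borel_measurable N2"
    if "h \<in> borel_measurable N" for h :: "'a \<Rightarrow> ennreal"
    using that s by (simp_all cong: measurable_cong_sets)
  show ?thesis using g
  proof (induction rule: borel_measurable_induct)
    case (cong f h)
    thus ?case using nn_integral_cong[of N f h] nn_integral_cong[of N1 f h] nn_integral_cong[of N2 f h] sp
      by simp
  next
    case (set A)
    thus ?case using s e by simp
  next
    case (mult u c)
    show ?case
      unfolding nn_integral_cmult[OF mult(2)] nn_integral_cmult[OF m(1)[OF mult(2)]]
        nn_integral_cmult[OF m(2)[OF mult(2)]] mult.IH by (rule distrib_left)
  next
    case (add u v)
    show ?case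
      unfolding nn_integral_add[OF add(3,1)] nn_integral_add[OF m(1)[OF add(3)] m(1)[OF add(1)]]
        nn_integral_add[OF m(2)[OF add(3)] m(2)[OF add(1)]] add.IH by (simp only: ac_simps)
  next
    case (seq U)
    have *: "(\<integral>\<^sup>+x. (SUP i. U i) x \<partial>K) = (SUP i. \<integral>\<^sup>+x. U i x \<partial>K)"
      if "\<And>i. U i \<in> borel_measurable K" for K
      using nn_integral_monotone_convergence_SUP[OF seq(3) that] by (simp add: image_comp)
    have inc: "incseq (\<lambda>i. \<integral>\<^sup>+x. U i x \<partial>K)" for K
      using seq(3) by (auto simp: incseq_def le_fun_def intro!: nn_integral_mono)
    show ?case
      unfolding *[OF seq(1)] *[OF m(1)[OF seq(1)]] *[OF m(2)[OF seq(1)]] seq.IH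
      by (rule ennreal_SUP_add[OF inc inc])
  qed
qed

lemma integral_sum_measure:
  fixes g :: "'a \<Rightarrow> real"
  assumes s: "sets N1 = sets N" "sets N2 = sets N"
    and e: "\<And>A. A \<in> sets N \<Longrightarrow> emeasure N A = emeasure N1 A + emeasure N2 A"
    and g: "integrable N1 g" "integrable N2 g"
  shows "integrable N g" "(\<integral>x. g x \<partial>N) = (\<integral>x. g x \<partial>N1) + (\<integral>x. g x \<partial>N2)"
proof -
  have m [measurable]: "g \<in> borel_measurable N"
    using borel_measurable_integrable[OF g(1)] s(1) by (simp cong: measurable_cong_sets)
  note nn = nn_integral_sum_measure[OF s e]
  have a: "(\<integral>\<^sup>+x. ennreal (g x) \<partial>N) = (\<integral>\<^sup>+x. ennreal (g x) \<partial>N1) + (\<integral>\<^sup>+x. ennreal (g x) \<partial>N2)"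
    and b: "(\<integral>\<^sup>+x. ennreal (- g x) \<partial>N) = (\<integral>\<^sup>+x. ennreal (- g x) \<partial>N1) + (\<integral>\<^sup>+x. ennreal (- g x) \<partial>N2)"
    by (intro nn; simp)+
  have fin: "(\<integral>\<^sup>+x. ennreal (g x) \<partial>N1) < top" "(\<integral>\<^sup>+x. ennreal (g x) \<partial>N2) < top"
     "(\<integral>\<^sup>+x. ennreal (- g x) \<partial>N1) < top" "(\<integral>\<^sup>+x. ennreal (- g x) \<partial>N2) < top"
    using g by (simp_all add: real_integrable_def less_top)
  show i: "integrable N g"
    unfolding real_integrable_def a b using fin by (auto simp: less_top)
  show "(\<integral>x. g x \<partial>N) = (\<integral>x. g x \<partial>N1) + (\<integral>x. g x \<partial>N2)"
    using fin by (simp add: real_lebesgue_integral_def i g a b enn2real_plus)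
qed

section \<open>The support of a joint spectral measure\<close>

text \<open>
  Each of the two conditions of \<open>joint_spectral_measure\<close>, read off from real parts, says that \<open>T\<close> is
  the integral of one coordinate function \<open>\<phi>\<close>.
\<close>

definition spectral_integral ::
  "'a measure \<Rightarrow> ((real \<times> real) set \<Rightarrow> ('a \<Rightarrow> complex ^ 'n) \<Rightarrow> ('a \<Rightarrow> complex ^ 'n)) \<Rightarrow>
   (real \<times> real \<Rightarrow> real) \<Rightarrow> (('a \<Rightarrow> complex ^ 'n) \<Rightarrow> ('a \<Rightarrow> complex ^ 'n)) \<Rightarrow> bool" where
  "spectral_integral M P \<phi> T \<longleftrightarrow>
     projection_valued_measure M P \<and> \<phi> \<in> borel_measurable borel \<and>
     L2_operator M T \<and>
     (\<forall>f\<in>L2 M. \<forall>g\<in>L2 M. L2_rinner M (T f) g = L2_rinner M f (T g)) \<and>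
     (\<forall>f\<in>L2 M. integrable (scalar_spectral_measure M P f) \<phi> \<and>
        L2_rinner M f (T f) = (\<integral>x. \<phi> x \<partial>scalar_spectral_measure M P f))"

lemma spectral_integralD:
  assumes "spectral_integral M P \<phi> T"
  shows "projection_valued_measure M P" "\<phi> \<in> borel_measurable borel" "L2_operator M T"
    and "f \<in> L2 M \<Longrightarrow> g \<in> L2 M \<Longrightarrow> L2_rinner M (T f) g = L2_rinner M f (T g)"
    and "f \<in> L2 M \<Longrightarrow> integrable (scalar_spectral_measure M P f) \<phi>"
    and "f \<in> L2 M \<Longrightarrow> L2_rinner M f (T f) = (\<integral>x. \<phi> x \<partial>scalar_spectral_measure M P f)"
  using assms by (simp_all add: spectral_integral_def)

text \<open>\<open>P C\<close> commutes with \<open>P B\<close>, because both products are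
  \<open>P (B \<inter> C)\<close>. Hence \<open>P B\<close> can be moved from \<open>f\<close> to
  \<open>g\<close>, which it annihilates.\<close>

lemma pvm_rinner_orthogonal:
  assumes P: "projection_valued_measure M P" and B: "B \<in> sets borel" and C: "C \<in> sets borel"
    and f: "f \<in> L2 M" "L2_eq M (P B f) f" and g: "g \<in> L2 M" "L2_eq M (P B g) (\<lambda>_. 0)"
  shows "L2_rinner M f (P C g) = 0"
proof -
  note L = pvm_L2[OF P]
  have "L2_rinner M f (P C g) = L2_rinner M (P B f) (P C g)"
    using f g B C by (intro L2_rinner_cong L2_eq_refl L2_eq_sym[OF f(2)]) (auto intro: L)
  also have "\<dots> = L2_rinner M f (P B (P C g))"
    using f g B C by (intro L2_orthogonal_projectionD(3) projection_valued_measureD(1)[OF P] L)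
  also have "\<dots> = L2_rinner M f (P (B \<inter> C) g)"
    using f g B C by (intro L2_rinner_cong L2_eq_refl L2_eq_sym[OF projection_valued_measureD(3)[OF P]] L) auto
  also have "\<dots> = L2_rinner M f (P (C \<inter> B) g)"
    by (simp add: Int_commute)
  also have "\<dots> = L2_rinner M f (P C (P B g))"
    using f g B C by (intro L2_rinner_cong L2_eq_refl projection_valued_measureD(3)[OF P] L) auto
  also have "\<dots> = L2_rinner M f (P C (\<lambda>_. 0))"
    using f g B C by (intro L2_rinner_cong L2_eq_refl L2_operatorD(2)[OF pvm_operator[OF P C]] L) auto
  also have "\<dots> = L2_rinner M f (\<lambda>_. 0)"
    using f C by (intro L2_rinner_cong L2_eq_refl L2_operator_zero[OF pvm_operator[OF P C]] L) auto
  finally show ?thesis by simp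
qed

text \<open>
  The two scalar spectral measures add up because the mixed terms vanish; polarization then shows
  that \<open>T\<close> leaves the range of every spectral projection invariant.
\<close>

lemma spectral_integral_orthogonal:
  assumes T: "spectral_integral M P \<phi> T" and B: "B \<in> sets borel"
    and f: "f \<in> L2 M" "L2_eq M (P B f) f" and g: "g \<in> L2 M" "L2_eq M (P B g) (\<lambda>_. 0)"
  shows "L2_rinner M f (T g) = 0"
proof -
  note T' = spectral_integralD[OF T]
  note P = T'(1)
  note L = pvm_L2[OF P] L2_operatorD(1)[OF T'(3)]
  let ?h = "\<lambda>x. f x + g x"
  have h: "?h \<in> L2 M" using f g by auto
  have e: "emeasure (scalar_spectral_measure M P ?h) C =
      emeasure (scalar_spectral_measure M P f) C + emeasure (scalar_spectral_measure M P g) C"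
    if "C \<in> sets (scalar_spectral_measure M P ?h)" for C
  proof -
    have C: "C \<in> sets borel" using that by simp
    have 1: "L2_rinner M f (P C g) = 0"
      by (rule pvm_rinner_orthogonal[OF P B C f g])
    have 2: "L2_rinner M g (P C f) = 0"
      using 1 L2_orthogonal_projectionD(3)[OF projection_valued_measureD(1)[OF P C] f(1) g(1)]
      by (simp add: L2_rinner_commute)
    have "L2_rinner M ?h (P C ?h) = L2_rinner M f (P C f) + L2_rinner M g (P C g)"
      using f g h 1 2 pvm_L2[OF P C]
      by (simp add: L2_rinner_add(1) L2_rinner_operator(1)[OF pvm_operator[OF P C]])
    thus ?thesis
      using f g h C by (simp add: emeasure_scalar_spectral_measure[OF P] pvm_rinner_eq_norm[OF P] flip: ennreal_plus)
  qed
  have "L2_rinner M ?h (T ?h) = L2_rinner M f (T f) + L2_rinner M g (T g)"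
    using integral_sum_measure(2)[OF _ _ e T'(5)[OF f(1)] T'(5)[OF g(1)]]
    by (simp add: T'(6) f g h)
  moreover have "L2_rinner M ?h (T ?h) =
      L2_rinner M f (T f) + L2_rinner M f (T g) + L2_rinner M g (T f) + L2_rinner M g (T g)"
    using f g h by (simp add: L2_rinner_add L2_rinner_operator(1)[OF T'(3)] L)
  moreover have "L2_rinner M g (T f) = L2_rinner M f (T g)"
    using T'(4)[OF f(1) g(1)] by (simp add: L2_rinner_commute)
  ultimately show ?thesis by simp
qed

text \<open>Splits a vector into a part in the range of \<open>P B\<close> and a part annihilated by
  \<open>P B\<close>, the two kinds of vectors in the orthogonality lemmas.\<close>

lemma pvm_residual:
  assumes P: "projection_valued_measure M P" and B: "B \<in> sets borel" and f: "f \<in> L2 M"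
  shows "L2_eq M (P B (P B f)) (P B f)" and "L2_eq M (P B (\<lambda>x. f x - P B f x)) (\<lambda>_. 0)"
proof -
  show *: "L2_eq M (P B (P B f)) (P B f)"
    by (rule L2_orthogonal_projectionD(2)[OF projection_valued_measureD(1)[OF P B] f])
  have "L2_eq M (P B (\<lambda>x. f x - P B f x)) (\<lambda>x. P B f x - P B (P B f) x)"
    by (intro L2_operator_diff pvm_operator[OF P B] pvm_L2[OF P B f] f)
  with * show "L2_eq M (P B (\<lambda>x. f x - P B f x)) (\<lambda>_. 0)"
    unfolding L2_eq_def by eventually_elim simp
qed

text \<open>The scalar measure of \<open>f\<close> lives on \<open>B\<close>, so a pointwise bound
  on \<open>B\<close> can be integrated. The factor \<open>s\<close>, later 1 or -1, lets one
  statement serve for lower and upper bounds.\<close>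

lemma spectral_integral_ge:
  assumes T: "spectral_integral M P \<phi> T" and B: "B \<in> sets borel"
    and f: "f \<in> L2 M" "L2_eq M (P B f) f"
    and le: "\<And>x. x \<in> B \<Longrightarrow> r \<le> s * (\<phi> x - c)"
  shows "r * (L2_norm M f)\<^sup>2 \<le> s * (L2_rinner M f (T f) - c * (L2_norm M f)\<^sup>2)"
proof -
  note T' = spectral_integralD[OF T]
  note P = T'(1)
  let ?N = "scalar_spectral_measure M P f"
  interpret finite_measure ?N by (rule finite_scalar_spectral_measure[OF P f(1)])
  have m: "measure ?N UNIV = (L2_norm M f)\<^sup>2"
    using emeasure_scalar_spectral_measure_UNIV[OF P f(1)] by (simp add: measure_def)
  have "r * (L2_norm M f)\<^sup>2 = (\<integral>x. r \<partial>?N)"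
    using m by simp
  also have "\<dots> \<le> (\<integral>x. s * (\<phi> x - c) \<partial>?N)"
  proof (rule integral_mono_AE)
    show "AE x in ?N. r \<le> s * (\<phi> x - c)"
      using AE_scalar_spectral_measure[OF P f(1) B f(2)] by eventually_elim (rule le)
  qed (use T'(5)[OF f(1)] in simp_all)
  also have "\<dots> = s * (L2_rinner M f (T f) - c * (L2_norm M f)\<^sup>2)"
    using T'(5)[OF f(1)] T'(6)[OF f(1)] m by simp
  finally show ?thesis .
qed

text \<open>On the range of \<open>P B\<close> the form of \<open>T - c\<close> is at most
  \<open>\<epsilon>\<close> times the squared norm. For a symmetric operator preserving this range,
  a bound on the form is a bound on the operator norm; the proof is the parallelogram argument
  behind that fact.\<close>

lemma spectral_integral_approx:
  assumes T: "spectral_integral M P \<phi> T" and B: "B \<in> sets borel"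
    and f: "f \<in> L2 M" "L2_eq M (P B f) f" "L2_norm M f > 0"
    and le: "\<And>x. x \<in> B \<Longrightarrow> \<bar>\<phi> x - c\<bar> \<le> \<epsilon>"
  shows "L2_norm M (\<lambda>x. T f x - c *\<^sub>R f x) \<le> \<epsilon> * L2_norm M f"
proof -
  note T' = spectral_integralD[OF T]
  note P = T'(1)
  note L = pvm_L2[OF P B] L2_operatorD(1)[OF T'(3)]
  define q where "q g = L2_rinner M g (T g) - c * (L2_norm M g)\<^sup>2" for g
  have q: "\<bar>q g\<bar> \<le> \<epsilon> * (L2_norm M g)\<^sup>2" if "g \<in> L2 M" "L2_eq M (P B g) g" for g
  proof -
    have "- \<epsilon> \<le> 1 * (\<phi> x - c)" "- \<epsilon> \<le> (-1) * (\<phi> x - c)" if "x \<in> B" for x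
      using le[OF that] by (auto simp: abs_le_iff)
    hence "- \<epsilon> * (L2_norm M g)\<^sup>2 \<le> 1 * q g" "- \<epsilon> * (L2_norm M g)\<^sup>2 \<le> (-1) * q g"
      unfolding q_def using spectral_integral_ge[OF T B that(1,2)] by blast+
    thus ?thesis by (simp add: abs_le_iff)
  qed
  let ?h = "\<lambda>x. T f x - c *\<^sub>R f x"
  let ?h1 = "P B ?h"
  let ?h2 = "\<lambda>x. ?h x - ?h1 x"
  have h: "?h \<in> L2 M" using f by (auto intro: L)
  have h1: "?h1 \<in> L2 M" by (rule L(1)[OF h])
  have h2: "?h2 \<in> L2 M" using h h1 by auto
  note res = pvm_residual[OF P B h]
  \<comment> \<open>\<open>?h\<close> is orthogonal to its component \<open>?h2\<close> outside the
    range of \<open>P B\<close>, so its inner product with \<open>?h1\<close> is its full squared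
    norm.\<close>
  have "L2_rinner M (T f) ?h2 = 0"
    using spectral_integral_orthogonal[OF T B f(1,2) h2 res(2)] T'(4) f(1) h2 by simp
  moreover have "L2_rinner M f ?h2 = 0"
  proof -
    have "L2_rinner M f ?h2 = L2_rinner M f (P UNIV ?h2)"
      by (intro L2_rinner_cong L2_eq_refl L2_eq_sym[OF projection_valued_measureD(2)[OF P]] f h2 pvm_L2[OF P]) auto
    also have "\<dots> = 0" by (intro pvm_rinner_orthogonal[OF P B _ f(1,2) h2 res(2)]) auto
    finally show ?thesis .
  qed
  ultimately have "L2_rinner M ?h ?h2 = 0"
    using f h2 by (simp add: L2_rinner_diff(1) L2_rinner_scaleR L L2_scaleR)
  hence hh1: "L2_rinner M ?h ?h1 = (L2_norm M ?h)\<^sup>2"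
    using h h1 by (simp add: L2_rinner_diff(2) L2_rinner_self)
  have h1_le: "(L2_norm M ?h1)\<^sup>2 = (L2_norm M ?h)\<^sup>2"
    using pvm_rinner_eq_norm[OF P B h] hh1 by simp
  show ?thesis
  proof (cases "L2_norm M ?h = 0")
    case True
    have "0 \<le> \<epsilon> * (L2_norm M f)\<^sup>2" using q[OF f(1,2)] by linarith
    hence "0 \<le> \<epsilon>" using f(3) by (simp add: zero_le_mult_iff)
    thus ?thesis using True by simp
  next
    case False
    hence hpos: "L2_norm M ?h > 0" using L2_norm_nonneg[of M ?h] by linarith
    \<comment> \<open>\<open>\<theta>\<close> scales \<open>?h1\<close> to the length of
      \<open>f\<close>; with equal lengths the parallelogram law loses nothing. The difference of
      \<open>q\<close> at the two diagonals is four times the mixed term of the symmetric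
      form.\<close>
    define \<theta> where "\<theta> = L2_norm M f / L2_norm M ?h"
    have \<theta>: "\<theta> > 0" using hpos f(3) by (simp add: \<theta>_def)
    let ?p = "\<lambda>x. f x + \<theta> *\<^sub>R ?h1 x" and ?m = "\<lambda>x. f x - \<theta> *\<^sub>R ?h1 x"
    have th: "(\<lambda>x. \<theta> *\<^sub>R ?h1 x) \<in> L2 M" using h1 by auto
    have pm: "?p \<in> L2 M" "?m \<in> L2 M" using f h1 by auto
    have Pth: "L2_eq M (P B (\<lambda>x. \<theta> *\<^sub>R ?h1 x)) (\<lambda>x. \<theta> *\<^sub>R ?h1 x)"
      using L2_operatorD(4)[OF pvm_operator[OF P B] h1, of \<theta>] res(1)
      unfolding L2_eq_def by eventually_elim simp
    have Pp: "L2_eq M (P B ?p) ?p"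
      using L2_operatorD(3)[OF pvm_operator[OF P B] f(1) th] Pth f(2)
      unfolding L2_eq_def by eventually_elim simp
    have Pm: "L2_eq M (P B ?m) ?m"
      using L2_operator_diff[OF pvm_operator[OF P B] f(1) th] Pth f(2)
      unfolding L2_eq_def by eventually_elim simp
    have sym: "L2_rinner M ?h1 (T f) = L2_rinner M (T f) ?h1" "L2_rinner M f (T ?h1) = L2_rinner M (T f) ?h1"
      using T'(4)[OF f(1) h1] by (simp_all add: L2_rinner_commute)
    have ex: "L2_rinner M ?h ?h1 = L2_rinner M (T f) ?h1 - c * L2_rinner M f ?h1"
      using f h1 by (simp add: L2_rinner_diff(1) L2_rinner_scaleR L L2_scaleR)
    have "q ?p - q ?m = 4 * \<theta> * L2_rinner M ?h ?h1"
      unfolding q_def ex L2_rinner_self[symmetric]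
      using f(1) h1 th pm
      by (simp add: L2_rinner_add L2_rinner_diff L2_rinner_scaleR L2_rinner_operator[OF T'(3)] L sym
          L2_rinner_commute[of M ?h1 f] algebra_simps)
    hence "4 * \<theta> * (L2_norm M ?h)\<^sup>2 = q ?p - q ?m" using hh1 by simp
    also have "\<dots> \<le> \<epsilon> * ((L2_norm M ?p)\<^sup>2 + (L2_norm M ?m)\<^sup>2)"
      using q[OF pm(1) Pp] q[OF pm(2) Pm] by (simp add: distrib_left)
    also have "(L2_norm M ?p)\<^sup>2 + (L2_norm M ?m)\<^sup>2 = 2 * (L2_norm M f)\<^sup>2 + 2 * \<theta>\<^sup>2 * (L2_norm M ?h1)\<^sup>2"
      unfolding L2_rinner_self[symmetric] using f(1) h1 th pm
      by (simp add: L2_rinner_add L2_rinner_diff L2_rinner_scaleR power2_eq_square algebra_simps)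
    also have "\<dots> = 4 * (L2_norm M f)\<^sup>2"
      using hpos by (simp add: h1_le \<theta>_def power_divide)
    finally have "\<theta> * (L2_norm M ?h)\<^sup>2 \<le> \<epsilon> * (L2_norm M f)\<^sup>2" by simp
    hence "L2_norm M f * L2_norm M ?h \<le> L2_norm M f * (\<epsilon> * L2_norm M f)"
      using hpos by (simp add: \<theta>_def power2_eq_square algebra_simps)
    thus ?thesis using f(3) by simp
  qed
qed

text \<open>A Chebyshev inequality. Pairing \<open>T f - c f\<close> with \<open>P B f\<close> sees
  only the part of \<open>f\<close> in the range of \<open>P B\<close>, where \<open>s\<close> times
  the form of \<open>T - c\<close> is at least \<open>r\<close> times the squared norm;
  Cauchy-Schwarz bounds the same pairing from above.\<close>

lemma spectral_integral_tail:
  assumes T: "spectral_integral M P \<phi> T" and f: "f \<in> L2 M" and r: "r > 0"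
    and s: "\<bar>s\<bar> = 1" and B: "B \<in> sets borel" and le: "\<And>x. x \<in> B \<Longrightarrow> r \<le> s * (\<phi> x - c)"
    and approx: "L2_norm M (\<lambda>x. T f x - c *\<^sub>R f x) \<le> \<epsilon> * L2_norm M f"
  shows "r * L2_norm M (P B f) \<le> \<epsilon> * L2_norm M f"
proof (cases "L2_norm M (P B f) = 0")
  case True
  have "0 \<le> \<epsilon> * L2_norm M f" using approx L2_norm_nonneg order_trans by blast
  thus ?thesis using True by simp
next
  case False
  note T' = spectral_integralD[OF T]
  note P = T'(1)
  note L = pvm_L2[OF P B] L2_operatorD(1)[OF T'(3)]
  let ?f1 = "P B f" and ?f2 = "\<lambda>x. f x - P B f x" and ?h = "\<lambda>x. T f x - c *\<^sub>R f x"
  have f1: "?f1 \<in> L2 M" by (rule L(1)[OF f])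
  have f2: "?f2 \<in> L2 M" using f f1 by auto
  have h: "?h \<in> L2 M" using f by (auto intro: L)
  note res = pvm_residual[OF P B f]
  have pos: "L2_norm M ?f1 > 0" using False L2_norm_nonneg[of M ?f1] by linarith
  have "L2_rinner M ?f1 (T ?f2) = 0"
    by (rule spectral_integral_orthogonal[OF T B f1 res(1) f2 res(2)])
  hence a: "L2_rinner M ?f1 (T f) = L2_rinner M ?f1 (T ?f1)"
    using f f1 by (simp add: L2_rinner_operator[OF T'(3)])
  have b: "L2_rinner M ?f1 f = (L2_norm M ?f1)\<^sup>2"
    using pvm_rinner_eq_norm[OF P B f] by (simp add: L2_rinner_commute)
  have "r * (L2_norm M ?f1)\<^sup>2 \<le> s * (L2_rinner M ?f1 (T ?f1) - c * (L2_norm M ?f1)\<^sup>2)"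
    by (rule spectral_integral_ge[OF T B f1 res(1) le])
  also have "\<dots> = s * L2_rinner M ?f1 ?h"
    using f f1 a b by (simp add: L2_rinner_diff L2_rinner_scaleR L L2_scaleR)
  also have "\<dots> \<le> \<bar>s\<bar> * \<bar>L2_rinner M ?f1 ?h\<bar>"
    using abs_ge_self[of "s * L2_rinner M ?f1 ?h"] by (simp only: abs_mult)
  also have "\<dots> \<le> L2_norm M ?f1 * L2_norm M ?h"
    using abs_L2_rinner_le[OF f1 h] s by simp
  also have "\<dots> \<le> L2_norm M ?f1 * (\<epsilon> * L2_norm M f)"
    using approx by (intro mult_left_mono) auto
  finally have "L2_norm M ?f1 * (r * L2_norm M ?f1) \<le> L2_norm M ?f1 * (\<epsilon> * L2_norm M f)"
    by (simp add: power2_eq_square algebra_simps)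
  thus ?thesis using pos by simp
qed

definition joint_approx_eigenvalue ::
  "'a measure \<Rightarrow> (('a \<Rightarrow> complex ^ 'n) \<Rightarrow> ('a \<Rightarrow> complex ^ 'n)) \<Rightarrow>
   (('a \<Rightarrow> complex ^ 'n) \<Rightarrow> ('a \<Rightarrow> complex ^ 'n)) \<Rightarrow> real \<times> real \<Rightarrow> bool" where
  "joint_approx_eigenvalue M T1 T2 c \<longleftrightarrow>
     (\<forall>\<epsilon>>0. \<exists>f\<in>L2 M. L2_norm M f > 0 \<and>
        L2_norm M (\<lambda>x. T1 f x - fst c *\<^sub>R f x) \<le> \<epsilon> * L2_norm M f \<and>
        L2_norm M (\<lambda>x. T2 f x - snd c *\<^sub>R f x) \<le> \<epsilon> * L2_norm M f)"

lemma pvm_support_eq: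
  assumes T1: "spectral_integral M P fst T1" and T2: "spectral_integral M P snd T2"
  shows "pvm_support M P = {c. joint_approx_eigenvalue M T1 T2 c}"
proof (intro set_eqI iffI CollectI)
  note P = spectral_integralD(1)[OF T1]
  fix c assume c: "c \<in> pvm_support M P"
  show "joint_approx_eigenvalue M T1 T2 c"
    unfolding joint_approx_eigenvalue_def
  proof (intro allI impI)
    fix \<epsilon> :: real assume \<epsilon>: "\<epsilon> > 0"
    let ?U = "ball c \<epsilon>"
    have U: "?U \<in> sets borel" by simp
    obtain f where f: "f \<in> L2 M" "\<not> L2_eq M (P ?U f) (\<lambda>_. 0)"
      using c \<epsilon> unfolding pvm_support_def mem_Collect_eq by (meson centre_in_ball open_ball)
    let ?g = "P ?U f"
    have g: "?g \<in> L2 M" by (rule pvm_L2[OF P U f(1)])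
    have gg: "L2_eq M (P ?U ?g) ?g" by (rule pvm_residual(1)[OF P U f(1)])
    have pos: "L2_norm M ?g > 0"
      using f(2) L2_norm_eq_0_iff[OF g] L2_norm_nonneg[of M ?g] by linarith
    have 1: "\<bar>fst x - fst c\<bar> \<le> \<epsilon>" if "x \<in> ?U" for x
      using that dist_fst_le[of x c] by (simp add: dist_commute dist_real_def)
    have 2: "\<bar>snd x - snd c\<bar> \<le> \<epsilon>" if "x \<in> ?U" for x
      using that dist_snd_le[of x c] by (simp add: dist_commute dist_real_def)
    show "\<exists>f\<in>L2 M. L2_norm M f > 0 \<and>
        L2_norm M (\<lambda>x. T1 f x - fst c *\<^sub>R f x) \<le> \<epsilon> * L2_norm M f \<and>
        L2_norm M (\<lambda>x. T2 f x - snd c *\<^sub>R f x) \<le> \<epsilon> * L2_norm M f"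
      using g pos spectral_integral_approx[OF T1 U g gg pos 1] spectral_integral_approx[OF T2 U g gg pos 2]
      by blast
  qed
next
  note P = spectral_integralD(1)[OF T1]
  fix c assume "c \<in> {c. joint_approx_eigenvalue M T1 T2 c}"
  hence c: "joint_approx_eigenvalue M T1 T2 c" by simp
  show "c \<in> pvm_support M P"
  proof (rule ccontr)
    assume "c \<notin> pvm_support M P"
    then obtain U where U: "open U" "c \<in> U" "\<And>f. f \<in> L2 M \<Longrightarrow> L2_eq M (P U f) (\<lambda>_. 0)"
      unfolding pvm_support_def by blast
    obtain e where e: "e > 0" "ball c e \<subseteq> U" using U(1,2) openE by blast
    \<comment> \<open>Two coordinate deviations below \<open>e / 2\<close> add up to a distance
      below \<open>e\<close>, so the open square of half side \<open>r\<close> around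
      \<open>c\<close> lies in \<open>U\<close>.\<close>
    define r where "r = e / 2"
    have r: "r > 0" using e by (simp add: r_def)
    \<comment> \<open>With error \<open>r / 4\<close> each of the four half planes carries at most
      1/16 of the squared norm, together at most 1/4, and \<open>U\<close> carries nothing: too
      little for the total mass.\<close>
    obtain f where f: "f \<in> L2 M" "L2_norm M f > 0"
      and 1: "L2_norm M (\<lambda>x. T1 f x - fst c *\<^sub>R f x) \<le> r / 4 * L2_norm M f"
      and 2: "L2_norm M (\<lambda>x. T2 f x - snd c *\<^sub>R f x) \<le> r / 4 * L2_norm M f"
      using c[unfolded joint_approx_eigenvalue_def, rule_format, of "r / 4"] r by auto
    define H where "H \<phi> s = {x :: real \<times> real. r \<le> s * (\<phi> x - \<phi> c)}" for \<phi> s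
    have H: "H fst s \<in> sets borel" "H snd s \<in> sets borel" for s
      unfolding H_def by (intro borel_closed closed_Collect_le continuous_intros)+
    have cov: "UNIV \<subseteq> U \<union> (H fst 1 \<union> (H fst (-1) \<union> (H snd 1 \<union> H snd (-1))))"
    proof
      fix x
      show "x \<in> U \<union> (H fst 1 \<union> (H fst (-1) \<union> (H snd 1 \<union> H snd (-1))))"
      proof (rule ccontr)
        assume "\<not> ?thesis"
        hence lt: "\<bar>fst x - fst c\<bar> < r" "\<bar>snd x - snd c\<bar> < r" and xU: "x \<notin> U"
          by (auto simp: H_def)
        have "dist c x \<le> \<bar>fst x - fst c\<bar> + \<bar>snd x - snd c\<bar>"
          unfolding dist_prod_def using sqrt_sum_squares_le_sum_abs[of "dist (fst c) (fst x)" "dist (snd c) (snd x)"]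
          by (simp add: dist_real_def abs_minus_commute)
        also have "\<dots> < e" using lt by (simp add: r_def)
        finally show False using e(2) xU by auto
      qed
    qed
    let ?N = "scalar_spectral_measure M P f"
    have t: "emeasure ?N (H \<phi> s) \<le> ennreal ((L2_norm M f)\<^sup>2 / 16)"
      if H: "H \<phi> s \<in> sets borel" and T: "spectral_integral M P \<phi> T" and s: "\<bar>s\<bar> = 1"
        and ap: "L2_norm M (\<lambda>x. T f x - \<phi> c *\<^sub>R f x) \<le> r / 4 * L2_norm M f" for \<phi> s T
    proof -
      have "r * L2_norm M (P (H \<phi> s) f) \<le> r / 4 * L2_norm M f"
        by (rule spectral_integral_tail[OF T f(1) r s H _ ap]) (simp add: H_def)
      hence "L2_norm M (P (H \<phi> s) f) \<le> L2_norm M f / 4" using r by simp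
      from power_mono[OF this L2_norm_nonneg, of 2]
      show ?thesis
        unfolding emeasure_scalar_spectral_measure_norm[OF P f(1) H]
        by (intro ennreal_leI) (simp add: power_divide)
    qed
    have sm: "emeasure ?N (A \<union> B) \<le> a + b"
      if "A \<in> sets borel" "B \<in> sets borel" "emeasure ?N A \<le> a" "emeasure ?N B \<le> b" for A B a b
      using emeasure_subadditive[of A ?N B] that by (simp add: add_mono order_trans)
    have "emeasure ?N U = 0"
      using U(1) U(3)[OF f(1)] L2_norm_eq_0_iff[OF pvm_L2[OF P _ f(1)], of U]
      by (simp add: emeasure_scalar_spectral_measure_norm[OF P f(1)])
    hence "emeasure ?N (U \<union> (H fst 1 \<union> (H fst (-1) \<union> (H snd 1 \<union> H snd (-1)))))
       \<le> 0 + (ennreal ((L2_norm M f)\<^sup>2 / 16) + (ennreal ((L2_norm M f)\<^sup>2 / 16) +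
          (ennreal ((L2_norm M f)\<^sup>2 / 16) + ennreal ((L2_norm M f)\<^sup>2 / 16))))"
      using U(1) H by (intro sm t[OF _ T1 _ 1] t[OF _ T2 _ 2] sets.Un) auto
    also have "\<dots> = ennreal ((L2_norm M f)\<^sup>2 / 4)"
      by (simp flip: ennreal_plus)
    finally have "emeasure ?N UNIV \<le> ennreal ((L2_norm M f)\<^sup>2 / 4)"
      using cov by (simp add: top.extremum_unique)
    hence "(L2_norm M f)\<^sup>2 \<le> (L2_norm M f)\<^sup>2 / 4"
      by (simp add: emeasure_scalar_spectral_measure_UNIV[OF P f(1)])
    thus False using f(2) by simp
  qed
qed


section \<open>Multiplication operators diagonal with respect to a field of projections\<close>

definition hermitian_projection :: "complex ^ 'n ^ 'n \<Rightarrow> bool" where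
  "hermitian_projection Q \<longleftrightarrow>
     Q ** Q = Q \<and> (\<forall>x y. cvec_inner (Q *v x) y = cvec_inner x (Q *v y))"

lemma cvec_inner_add: "cvec_inner (x + y) z = cvec_inner x z + cvec_inner y z"
    "cvec_inner z (x + y) = cvec_inner z x + cvec_inner z y"
  by (simp_all add: cvec_inner_def algebra_simps sum.distrib)

lemma cvec_inner_diff: "cvec_inner (x - y) z = cvec_inner x z - cvec_inner y z"
    "cvec_inner z (x - y) = cvec_inner z x - cvec_inner z y"
  by (simp_all add: cvec_inner_def algebra_simps sum_subtractf)

lemma cvec_inner_scaleR: "cvec_inner (c *\<^sub>R x) z = of_real c * cvec_inner x z"
    "cvec_inner z (c *\<^sub>R x) = of_real c * cvec_inner z x"
  by (simp_all add: cvec_inner_def sum_distrib_left ac_simps flip: of_real_vector_smult)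

lemma matrix_vector_mult_smult: "A *v (c *s x) = c *s (A *v (x :: complex ^ 'n))"
  by (simp add: vec_eq_iff matrix_vector_mult_def sum_distrib_left ac_simps)

context
  fixes Q :: "complex ^ 'n ^ 'n"
  assumes Q: "hermitian_projection Q"
begin

lemma hermitian_projection_idem: "Q *v (Q *v x) = Q *v x"
  using Q by (simp add: hermitian_projection_def matrix_vector_mul_assoc)

lemma hermitian_projection_sym: "cvec_inner (Q *v x) y = cvec_inner x (Q *v y)"
  using Q by (simp add: hermitian_projection_def)

lemma hermitian_projection_orthogonal: "cvec_inner (Q *v x) (y - Q *v y) = 0"
    "cvec_inner (x - Q *v x) (Q *v y) = 0"
  by (simp_all add: cvec_inner_diff hermitian_projection_sym hermitian_projection_idem)

lemma hermitian_projection_cvec_inner: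
  "cvec_inner x (\<alpha> *\<^sub>R (Q *v x) + \<beta> *\<^sub>R (x - Q *v x)) =
     of_real (\<alpha> * (norm (Q *v x))\<^sup>2 + \<beta> * (norm (x - Q *v x))\<^sup>2)"
proof -
  let ?y = "Q *v x" and ?z = "x - Q *v x"
  have "cvec_inner (?y + ?z) (\<alpha> *\<^sub>R ?y + \<beta> *\<^sub>R ?z) =
      of_real \<alpha> * cvec_inner ?y ?y + of_real \<beta> * cvec_inner ?z ?z"
    by (simp only: cvec_inner_add cvec_inner_scaleR hermitian_projection_orthogonal)
       (simp add: cvec_inner_def)
  thus ?thesis by (simp add: cvec_inner_self)
qed

lemma hermitian_projection_norm:
  "(norm (\<alpha> *\<^sub>R (Q *v x) + \<beta> *\<^sub>R (x - Q *v x)))\<^sup>2 =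
     \<alpha>\<^sup>2 * (norm (Q *v x))\<^sup>2 + \<beta>\<^sup>2 * (norm (x - Q *v x))\<^sup>2"
proof -
  have "(Q *v x) \<bullet> (x - Q *v x) = 0"
    by (simp add: inner_eq_Re_cvec_inner hermitian_projection_orthogonal)
  thus ?thesis
    unfolding power2_norm_eq_inner
    by (simp only: inner_add inner_scaleR_left inner_scaleR_right inner_commute[of "x - Q *v x" "Q *v x"])
       (simp add: power2_eq_square)
qed

lemma hermitian_projection_pythagoras:
  "(norm x)\<^sup>2 = (norm (Q *v x))\<^sup>2 + (norm (x - Q *v x))\<^sup>2"
  using hermitian_projection_norm[of 1 x 1] by simp

lemma hermitian_projection_norm_le:
  assumes "\<bar>\<alpha>\<bar> \<le> C" "\<bar>\<beta>\<bar> \<le> C"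
  shows "norm (\<alpha> *\<^sub>R (Q *v x) + \<beta> *\<^sub>R (x - Q *v x)) \<le> C * norm x"
proof (rule power2_le_imp_le)
  have "\<alpha>\<^sup>2 \<le> C\<^sup>2" "\<beta>\<^sup>2 \<le> C\<^sup>2" using assms by (simp_all add: abs_le_square_iff[symmetric])
  hence "\<alpha>\<^sup>2 * (norm (Q *v x))\<^sup>2 + \<beta>\<^sup>2 * (norm (x - Q *v x))\<^sup>2 \<le>
      C\<^sup>2 * (norm (Q *v x))\<^sup>2 + C\<^sup>2 * (norm (x - Q *v x))\<^sup>2"
    by (intro add_mono mult_right_mono) auto
  also have "\<dots> = (C * norm x)\<^sup>2"
    by (simp add: power_mult_distrib hermitian_projection_pythagoras[of x] distrib_left)
  finally show "(norm (\<alpha> *\<^sub>R (Q *v x) + \<beta> *\<^sub>R (x - Q *v x)))\<^sup>2 \<le> (C * norm x)\<^sup>2"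
    by (simp only: hermitian_projection_norm)
qed (use assms in \<open>auto intro: mult_nonneg_nonneg\<close>)

end

lemma borel_measurable_matrix_vector_mult:
  fixes A :: "'a \<Rightarrow> complex ^ 'n ^ 'm"
  assumes "A \<in> borel_measurable M" "f \<in> borel_measurable M"
  shows "(\<lambda>x. A x *v f x) \<in> borel_measurable M"
proof -
  have "continuous_on UNIV (\<lambda>p :: (complex ^ 'n ^ 'm) \<times> (complex ^ 'n). fst p *v snd p)"
    unfolding matrix_vector_mult_def by (intro continuous_intros continuous_on_vec_lambda)
  from borel_measurable_continuous_Pair[OF assms this] show ?thesis by simp
qed

lemma L2_norm_mono:
  assumes "g \<in> borel_measurable M" "f \<in> L2 M" "C \<ge> 0"
    and le: "\<And>x. x \<in> space M \<Longrightarrow> norm (g x) \<le> C * norm (f x)"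
  shows "L2_norm M g \<le> C * L2_norm M f"
proof -
  have g: "g \<in> L2 M" using L2_bounded[OF assms(1,2) le] .
  have "(\<integral>x. (norm (g x))\<^sup>2 \<partial>M) \<le> (\<integral>x. C\<^sup>2 * (norm (f x))\<^sup>2 \<partial>M)"
  proof (rule integral_mono)
    fix x assume "x \<in> space M"
    from power_mono[OF le[OF this], of 2]
    show "(norm (g x))\<^sup>2 \<le> C\<^sup>2 * (norm (f x))\<^sup>2" by (simp add: power_mult_distrib)
  qed (use L2_D(2)[OF g] L2_D(2)[OF assms(2)] in auto)
  hence "sqrt (\<integral>x. (norm (g x))\<^sup>2 \<partial>M) \<le> sqrt (C\<^sup>2 * (\<integral>x. (norm (f x))\<^sup>2 \<partial>M))"
    by simp
  thus ?thesis using \<open>C \<ge> 0\<close> by (simp add: L2_norm_def real_sqrt_mult)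
qed

text \<open>The rank may vary with the point. This admits the value 0 where the two eigenvalues of
  the walk coincide.\<close>

locale projection_field =
  fixes M :: "'a measure" and Q :: "'a \<Rightarrow> complex ^ 'n ^ 'n"
  assumes Q_measurable: "Q \<in> borel_measurable M"
    and Q_projection: "x \<in> space M \<Longrightarrow> hermitian_projection (Q x)"
begin

text \<open>Velocities, spectral projections and the remainders in countable additivity all have
  this form, so measurability, boundedness and symmetry are proved once for all of them.\<close>

definition diagonal :: "('a \<Rightarrow> real) \<Rightarrow> ('a \<Rightarrow> real) \<Rightarrow> (('a \<Rightarrow> complex ^ 'n) \<Rightarrow> ('a \<Rightarrow> complex ^ 'n)) \<Rightarrow> bool" where
  "diagonal \<alpha> \<beta> T \<longleftrightarrow> \<alpha> \<in> borel_measurable M \<and> \<beta> \<in> borel_measurable M \<and>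
     (\<exists>C\<ge>0. \<forall>x\<in>space M. \<bar>\<alpha> x\<bar> \<le> C \<and> \<bar>\<beta> x\<bar> \<le> C) \<and>
     (\<forall>f. \<forall>x\<in>space M. T f x = \<alpha> x *\<^sub>R (Q x *v f x) + \<beta> x *\<^sub>R (f x - Q x *v f x))"

lemma diagonal_apply:
  "diagonal \<alpha> \<beta> T \<Longrightarrow> x \<in> space M \<Longrightarrow> T f x = \<alpha> x *\<^sub>R (Q x *v f x) + \<beta> x *\<^sub>R (f x - Q x *v f x)"
  by (simp add: diagonal_def)

lemma Q_apply_measurable: "f \<in> L2 M \<Longrightarrow> (\<lambda>x. Q x *v f x) \<in> borel_measurable M"
  using borel_measurable_matrix_vector_mult Q_measurable L2_D(1) by blast

lemma diagonal_measurable: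
  assumes T: "diagonal \<alpha> \<beta> T" and f: "f \<in> L2 M"
  shows "T f \<in> borel_measurable M"
proof -
  have [measurable]: "\<alpha> \<in> borel_measurable M" "\<beta> \<in> borel_measurable M" "f \<in> borel_measurable M"
      "(\<lambda>x. Q x *v f x) \<in> borel_measurable M"
    using T L2_D(1)[OF f] Q_apply_measurable[OF f] by (simp_all add: diagonal_def)
  have "(\<lambda>x. \<alpha> x *\<^sub>R (Q x *v f x) + \<beta> x *\<^sub>R (f x - Q x *v f x)) \<in> borel_measurable M"
    by measurable
  thus ?thesis using diagonal_apply[OF T] by (simp cong: measurable_cong)
qed

lemma diagonal_operator:
  assumes T: "diagonal \<alpha> \<beta> T"
  shows "L2_operator M T"
proof -
  note ap = diagonal_apply[OF T]
  obtain C where C: "C \<ge> 0" "\<And>x. x \<in> space M \<Longrightarrow> \<bar>\<alpha> x\<bar> \<le> C" "\<And>x. x \<in> space M \<Longrightarrow> \<bar>\<beta> x\<bar> \<le> C"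
    using T by (auto simp: diagonal_def)
  have le: "norm (T f x) \<le> C * norm (f x)" if "x \<in> space M" for f x
    unfolding ap[OF that] using that C
    by (intro hermitian_projection_norm_le Q_projection) auto
  show ?thesis
    unfolding L2_operator_def
  proof (intro conjI ballI allI impI exI)
    fix f :: "'a \<Rightarrow> complex ^ 'n" assume f: "f \<in> L2 M"
    show "T f \<in> L2 M"
      by (rule L2_bounded[OF diagonal_measurable[OF T f] f le])
    show "L2_norm M (T f) \<le> C * L2_norm M f"
      by (rule L2_norm_mono[OF diagonal_measurable[OF T f] f C(1) le])
    show "L2_eq M (T (\<lambda>x. c *s f x)) (\<lambda>x. c *s T f x)" for c
      unfolding L2_eq_def
      by (intro AE_I2) (simp add: ap matrix_vector_mult_smult vec_eq_iff algebra_simps)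
    fix g :: "'a \<Rightarrow> complex ^ 'n" assume g: "g \<in> L2 M"
    show "L2_eq M (T (\<lambda>x. f x + g x)) (\<lambda>x. T f x + T g x)"
      unfolding L2_eq_def
      by (intro AE_I2) (simp add: ap matrix_vector_right_distrib algebra_simps)
    assume "L2_eq M f g"
    hence "AE x in M. x \<in> space M \<and> f x = g x" by (simp add: L2_eq_def)
    thus "L2_eq M (T f) (T g)"
      unfolding L2_eq_def by eventually_elim (simp add: ap)
  qed
qed

lemma diagonal_symmetric:
  assumes T: "diagonal \<alpha> \<beta> T"
  shows "L2_inner M (T f) g = L2_inner M f (T g)"
  unfolding L2_inner_def
proof (rule Bochner_Integration.integral_cong)
  fix x assume x: "x \<in> space M"
  show "cvec_inner (T f x) (g x) = cvec_inner (f x) (T g x)"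
    unfolding diagonal_apply[OF T x] using hermitian_projection_sym[OF Q_projection[OF x]]
    by (simp add: cvec_inner_add cvec_inner_diff cvec_inner_scaleR)
qed simp

text \<open>The scalars on the two components multiply pointwise. For indicator functions this gives
  idempotence and multiplicativity of the spectral projections.\<close>

lemma diagonal_comp:
  assumes S: "diagonal \<alpha> \<beta> S" and T: "diagonal \<alpha>' \<beta>' T" and R: "diagonal \<alpha>'' \<beta>'' R"
    and eq: "\<And>x. x \<in> space M \<Longrightarrow> \<alpha>'' x = \<alpha> x * \<alpha>' x" "\<And>x. x \<in> space M \<Longrightarrow> \<beta>'' x = \<beta> x * \<beta>' x"
  shows "L2_eq M (R f) (S (T f))"
  unfolding L2_eq_def
proof (intro AE_I2)
  fix x assume x: "x \<in> space M"
  let ?y = "Q x *v f x"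
  have "Q x *v T f x = \<alpha>' x *\<^sub>R ?y"
    unfolding diagonal_apply[OF T x]
    by (simp add: matrix_vector_right_distrib matrix_vector_mult_diff_distrib scaleR_matrix_vector_assoc
        flip: of_real_vector_smult)
       (simp add: matrix_vector_mult_smult hermitian_projection_idem[OF Q_projection[OF x]] matrix_vector_mult_diff_distrib)
  thus "R f x = S (T f) x"
    by (simp add: diagonal_apply[OF S x] diagonal_apply[OF R x] eq[OF x])
       (simp add: diagonal_apply[OF T x] algebra_simps)
qed

lemma diagonal_norm:
  assumes T: "diagonal \<alpha> \<beta> T" and x: "x \<in> space M"
  shows "(norm (T f x))\<^sup>2 = (\<alpha> x)\<^sup>2 * (norm (Q x *v f x))\<^sup>2 + (\<beta> x)\<^sup>2 * (norm (f x - Q x *v f x))\<^sup>2"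
  unfolding diagonal_apply[OF T x] by (rule hermitian_projection_norm[OF Q_projection[OF x]])

lemma diagonal_quadratic_form:
  assumes T: "diagonal \<alpha> \<beta> T"
  shows "L2_inner M f (T f) =
    of_real (\<integral>x. \<alpha> x * (norm (Q x *v f x))\<^sup>2 + \<beta> x * (norm (f x - Q x *v f x))\<^sup>2 \<partial>M)"
  unfolding L2_inner_def integral_complex_of_real[symmetric]
proof (rule Bochner_Integration.integral_cong)
  fix x assume x: "x \<in> space M"
  show "cvec_inner (f x) (T f x) =
    of_real (\<alpha> x * (norm (Q x *v f x))\<^sup>2 + \<beta> x * (norm (f x - Q x *v f x))\<^sup>2)"
    unfolding diagonal_apply[OF T x] by (rule hermitian_projection_cvec_inner[OF Q_projection[OF x]])
qed simp

lemma Q_L2: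
  assumes "f \<in> L2 M"
  shows "(\<lambda>x. Q x *v f x) \<in> L2 M" "(\<lambda>x. f x - Q x *v f x) \<in> L2 M"
proof -
  have "norm (Q x *v f x) \<le> 1 * norm (f x)" if "x \<in> space M" for x
    using hermitian_projection_norm_le[OF Q_projection[OF that], of 1 1 0 "f x"] by simp
  thus "(\<lambda>x. Q x *v f x) \<in> L2 M"
    by (rule L2_bounded[OF Q_apply_measurable[OF assms] assms])
  thus "(\<lambda>x. f x - Q x *v f x) \<in> L2 M" using assms by auto
qed

section \<open>An explicit joint spectral measure for eigenvalues \<open>v\<close> and
  \<open>- v\<close>\<close>

context
  fixes v :: "'a \<Rightarrow> real \<times> real" and K :: real
  assumes v_measurable [measurable]: "v \<in> borel_measurable M"
    and v_bounded: "x \<in> space M \<Longrightarrow> norm (v x) \<le> K"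
begin

text \<open>Functional calculus for the indicator of \<open>B\<close>, the joint eigenvalue being
  \<open>v x\<close> on the range of \<open>Q x\<close> and \<open>- v x\<close> on its
  complement.\<close>

definition spectral_projection :: "(real \<times> real) set \<Rightarrow> ('a \<Rightarrow> complex ^ 'n) \<Rightarrow> ('a \<Rightarrow> complex ^ 'n)" where
  "spectral_projection B f x =
     indicator B (v x) *\<^sub>R (Q x *v f x) + indicator B (- v x) *\<^sub>R (f x - Q x *v f x)"

lemma spectral_projection_diagonal:
  assumes [measurable]: "B \<in> sets borel"
  shows "diagonal (\<lambda>x. indicator B (v x)) (\<lambda>x. indicator B (- v x)) (spectral_projection B)"
  unfolding diagonal_def
proof (intro conjI)
  show "\<exists>C\<ge>0. \<forall>x\<in>space M. \<bar>indicator B (v x) :: real\<bar> \<le> C \<and> \<bar>indicator B (- v x) :: real\<bar> \<le> C"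
    by (rule exI[of _ 1]) (auto simp: indicator_def)
qed (simp_all add: spectral_projection_def)

text \<open>The remainder after \<open>n\<close> terms is again diagonal, with scalars that are
  bounded by 1 and tend to 0 pointwise; dominated convergence applies with the squared norm of
  \<open>f x\<close> as majorant.\<close>

lemma spectral_projection_countably_additive:
  fixes A :: "nat \<Rightarrow> (real \<times> real) set"
  assumes A: "range A \<subseteq> sets borel" "disjoint_family A" and f: "f \<in> L2 M"
  shows "(\<lambda>n. L2_norm M (\<lambda>x. (\<Sum>i<n. spectral_projection (A i) f x) - spectral_projection (\<Union>i. A i) f x))
    \<longlonglongrightarrow> 0"
proof -
  define \<delta> :: "nat \<Rightarrow> real \<times> real \<Rightarrow> real"
    where "\<delta> n y = indicator (\<Union>i<n. A i) y - indicator (\<Union>i. A i) y" for n y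
  have [measurable]: "A i \<in> sets borel" for i using A(1) by blast
  have [measurable]: "\<delta> n \<in> borel_measurable borel" for n
    unfolding \<delta>_def by measurable
  have \<delta>1: "\<bar>\<delta> n y\<bar> \<le> 1" for n y by (auto simp: \<delta>_def indicator_def)
  have \<delta>0: "(\<lambda>n. \<delta> n y) \<longlonglongrightarrow> 0" for y
    unfolding \<delta>_def by (rule LIM_zero[OF LIMSEQ_indicator_UN])
  define R where "R n g x = \<delta> n (v x) *\<^sub>R (Q x *v g x) + \<delta> n (- v x) *\<^sub>R (g x - Q x *v g x)" for n g x
  have R: "diagonal (\<lambda>x. \<delta> n (v x)) (\<lambda>x. \<delta> n (- v x)) (R n)" for n
    unfolding diagonal_def
  proof (intro conjI)
    show "\<exists>C\<ge>0. \<forall>x\<in>space M. \<bar>\<delta> n (v x)\<bar> \<le> C \<and> \<bar>\<delta> n (- v x)\<bar> \<le> C"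
      by (rule exI[of _ 1]) (simp add: \<delta>1)
  qed (simp_all add: R_def)
  have "(\<Sum>i<n. indicator (A i) y) = (indicator (\<Union>i<n. A i) y :: real)" for n y
    using A(2) by (intro indicator_UN_disjoint[symmetric]) (auto simp: disjoint_family_on_def)
  hence eq: "(\<Sum>i<n. spectral_projection (A i) f x) - spectral_projection (\<Union>i. A i) f x = R n f x" for n x
    by (simp add: spectral_projection_def R_def \<delta>_def sum.distrib scaleR_left_diff_distrib flip: scaleR_sum_left)
  have "(\<lambda>n. \<integral>x. (norm (R n f x))\<^sup>2 \<partial>M) \<longlonglongrightarrow> (\<integral>x. 0 \<partial>M)"
  proof (rule integral_dominated_convergence[where w = "\<lambda>x. (norm (f x))\<^sup>2"])
    show "(\<lambda>x. (norm (R n f x))\<^sup>2) \<in> borel_measurable M" for n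
      using diagonal_measurable[OF R f, of n] by measurable
    show "integrable M (\<lambda>x. (norm (f x))\<^sup>2)" by (rule L2_D(2)[OF f])
    show "AE x in M. (\<lambda>n. (norm (R n f x))\<^sup>2) \<longlonglongrightarrow> 0"
    proof (rule AE_I2)
      fix x assume x: "x \<in> space M"
      have "(\<lambda>n. (\<delta> n (v x))\<^sup>2 * (norm (Q x *v f x))\<^sup>2 + (\<delta> n (- v x))\<^sup>2 * (norm (f x - Q x *v f x))\<^sup>2) \<longlonglongrightarrow>
          0\<^sup>2 * (norm (Q x *v f x))\<^sup>2 + 0\<^sup>2 * (norm (f x - Q x *v f x))\<^sup>2"
        by (intro tendsto_intros \<delta>0)
      thus "(\<lambda>n. (norm (R n f x))\<^sup>2) \<longlonglongrightarrow> 0"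
        by (simp add: diagonal_norm[OF R x])
    qed
    show "AE x in M. norm ((norm (R n f x))\<^sup>2) \<le> (norm (f x))\<^sup>2" for n
    proof (rule AE_I2)
      fix x assume x: "x \<in> space M"
      have "norm (R n f x) \<le> 1 * norm (f x)"
        unfolding R_def by (intro hermitian_projection_norm_le Q_projection x \<delta>1)
      thus "norm ((norm (R n f x))\<^sup>2) \<le> (norm (f x))\<^sup>2" by (simp add: power_mono)
    qed
  qed simp
  hence "(\<lambda>n. sqrt (\<integral>x. (norm (R n f x))\<^sup>2 \<partial>M)) \<longlonglongrightarrow> sqrt 0"
    by (intro tendsto_real_sqrt) simp
  thus ?thesis by (simp add: L2_norm_def eq)
qed

lemma spectral_projection_pvm: "projection_valued_measure M spectral_projection"
proof -
  note D = spectral_projection_diagonal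
  have comp: "L2_eq M (spectral_projection (A \<inter> B) f) (spectral_projection A (spectral_projection B f))"
    if "A \<in> sets borel" "B \<in> sets borel" for A B f
    using that by (intro diagonal_comp[OF D D D]) (auto simp: indicator_def)
  show ?thesis
    unfolding projection_valued_measure_def L2_orthogonal_projection_def
  proof (intro conjI ballI allI impI)
    fix B :: "(real \<times> real) set" and f :: "'a \<Rightarrow> complex ^ 'n" assume B: "B \<in> sets borel" and f: "f \<in> L2 M"
    show "L2_eq M (spectral_projection B (spectral_projection B f)) (spectral_projection B f)"
      using comp[OF B B, of f] by (simp add: L2_eq_sym)
  next
    fix f :: "'a \<Rightarrow> complex ^ 'n" show "L2_eq M (spectral_projection UNIV f) f"
      by (simp add: L2_eq_def spectral_projection_def)
  next
    fix A :: "nat \<Rightarrow> (real \<times> real) set" and f :: "'a \<Rightarrow> complex ^ 'n"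
    assume "range A \<subseteq> sets borel \<and> disjoint_family A" "f \<in> L2 M"
    thus "(\<lambda>n. L2_norm M (\<lambda>x. (\<Sum>i<n. spectral_projection (A i) f x) -
        spectral_projection (\<Union>i. A i) f x)) \<longlonglongrightarrow> 0"
      by (intro spectral_projection_countably_additive) auto
  qed (use comp in \<open>auto intro: diagonal_operator[OF D] diagonal_symmetric[OF D]\<close>)
qed

text \<open>The scalar spectral measure of \<open>f\<close> will be a sum of two such image
  measures, with \<open>g\<close> one of the two components of \<open>f\<close> and \<open>w\<close>
  equal to \<open>v\<close> or \<open>- v\<close>.\<close>

lemma scalar_measure_component:
  fixes \<phi> :: "real \<times> real \<Rightarrow> real"
  assumes g: "g \<in> L2 M" and w [measurable]: "w \<in> borel_measurable M"
    and \<phi> [measurable]: "\<phi> \<in> borel_measurable borel"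
    and bound: "\<forall>x\<in>space M. \<bar>\<phi> (w x)\<bar> \<le> C"
  defines "N \<equiv> distr (density M (\<lambda>x. ennreal ((norm (g x))\<^sup>2))) borel w"
  shows "integrable M (\<lambda>x. \<phi> (w x) * (norm (g x))\<^sup>2)"
    and "integrable N \<phi>" and "(\<integral>y. \<phi> y \<partial>N) = (\<integral>x. \<phi> (w x) * (norm (g x))\<^sup>2 \<partial>M)"
    and "B \<in> sets borel \<Longrightarrow> emeasure N B = ennreal (\<integral>x. indicator B (w x) * (norm (g x))\<^sup>2 \<partial>M)"
proof -
  have [measurable]: "g \<in> borel_measurable M" using g by (rule L2_D(1))
  have ind: "integrable M (\<lambda>x. \<psi> (w x) * (norm (g x))\<^sup>2)"
    if [measurable]: "\<psi> \<in> borel_measurable borel" and le: "\<forall>x\<in>space M. \<bar>\<psi> (w x)\<bar> \<le> D" for \<psi> D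
  proof (rule Bochner_Integration.integrable_bound)
    show "integrable M (\<lambda>x. D * (norm (g x))\<^sup>2)" using L2_D(2)[OF g] by simp
    show "AE x in M. norm (\<psi> (w x) * (norm (g x))\<^sup>2) \<le> norm (D * (norm (g x))\<^sup>2)"
    proof (rule AE_I2)
      fix x assume "x \<in> space M"
      hence "\<bar>\<psi> (w x)\<bar> \<le> \<bar>D\<bar>" using bspec[OF le, of x] by linarith
      thus "norm (\<psi> (w x) * (norm (g x))\<^sup>2) \<le> norm (D * (norm (g x))\<^sup>2)"
        by (simp add: abs_mult mult_right_mono)
    qed
  qed measurable
  show i: "integrable M (\<lambda>x. \<phi> (w x) * (norm (g x))\<^sup>2)"
    by (rule ind[OF \<phi> bound])
  show "integrable N \<phi>"
    unfolding N_def using i by (simp add: integrable_distr_eq integrable_real_density mult.commute)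
  show "(\<integral>y. \<phi> y \<partial>N) = (\<integral>x. \<phi> (w x) * (norm (g x))\<^sup>2 \<partial>M)"
    unfolding N_def by (simp add: integral_distr integral_real_density mult.commute)
  assume B [measurable]: "B \<in> sets borel"
  have "emeasure N B = (\<integral>\<^sup>+x. ennreal ((norm (g x))\<^sup>2) * indicator (w -` B \<inter> space M) x \<partial>M)"
    unfolding N_def by (simp add: emeasure_distr emeasure_density)
  also have "\<dots> = (\<integral>\<^sup>+x. ennreal (indicator B (w x) * (norm (g x))\<^sup>2) \<partial>M)"
    by (intro nn_integral_cong) (auto simp: indicator_def)
  also have "\<dots> = ennreal (\<integral>x. indicator B (w x) * (norm (g x))\<^sup>2 \<partial>M)"
    by (intro nn_integral_eq_integral ind[where D = 1]) (auto simp: indicator_def)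
  finally show "emeasure N B = ennreal (\<integral>x. indicator B (w x) * (norm (g x))\<^sup>2 \<partial>M)" .
qed

text \<open>The scalar measure is the sum of the image measures of the two components. Oddness,
  which both coordinate functions have, turns the eigenvalue \<open>- v x\<close> into the scalar
  \<open>- \<phi> (v x)\<close> of \<open>T\<close>.\<close>

lemma spectral_projection_represents:
  assumes T: "diagonal (\<lambda>x. \<phi> (v x)) (\<lambda>x. - \<phi> (v x)) T" and \<phi>: "\<phi> \<in> borel_measurable borel"
    and odd: "\<And>y. \<phi> (- y) = - \<phi> y" and bound: "\<And>x. x \<in> space M \<Longrightarrow> \<bar>\<phi> (v x)\<bar> \<le> C"
    and f: "f \<in> L2 M"
  shows "integrable (scalar_spectral_measure M spectral_projection f) \<phi>"
    and "L2_inner M f (T f) = of_real (\<integral>x. \<phi> x \<partial>scalar_spectral_measure M spectral_projection f)"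
proof -
  let ?N = "scalar_spectral_measure M spectral_projection f"
  define N1 where "N1 = distr (density M (\<lambda>x. ennreal ((norm (Q x *v f x))\<^sup>2))) borel v"
  define N2 where "N2 = distr (density M (\<lambda>x. ennreal ((norm (f x - Q x *v f x))\<^sup>2))) borel (\<lambda>x. - v x)"
  have bounds: "\<forall>x\<in>space M. \<bar>\<phi> (v x)\<bar> \<le> C" "\<forall>x\<in>space M. \<bar>\<phi> (- v x)\<bar> \<le> C"
    using bound by (simp_all add: odd)
  have mm: "(\<lambda>x. - v x) \<in> borel_measurable M" by measurable
  note c1 = scalar_measure_component[OF Q_L2(1)[OF f] v_measurable \<phi> bounds(1), folded N1_def]
  note c2 = scalar_measure_component[OF Q_L2(2)[OF f] mm \<phi> bounds(2), folded N2_def]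
  have e: "emeasure ?N B = emeasure N1 B + emeasure N2 B" if "B \<in> sets ?N" for B
  proof -
    have B: "B \<in> sets borel" using that by simp
    have iB: "indicator B \<in> borel_measurable borel" using B by simp
    have b1: "\<forall>x\<in>space M. \<bar>indicator B (w x) :: real\<bar> \<le> 1" for w :: "'a \<Rightarrow> real \<times> real"
      by (simp add: indicator_def)
    note d1 = scalar_measure_component(1)[OF Q_L2(1)[OF f] v_measurable iB b1]
    note d2 = scalar_measure_component(1)[OF Q_L2(2)[OF f] mm iB b1]
    have "L2_rinner M f (spectral_projection B f) = Re (L2_inner M f (spectral_projection B f))"
      using f by (intro Re_L2_inner[symmetric] pvm_L2[OF spectral_projection_pvm B])
    also have "\<dots> = (\<integral>x. indicator B (v x) * (norm (Q x *v f x))\<^sup>2 \<partial>M) +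
        (\<integral>x. indicator B (- v x) * (norm (f x - Q x *v f x))\<^sup>2 \<partial>M)"
      using d1 d2 by (simp add: diagonal_quadratic_form[OF spectral_projection_diagonal[OF B]])
    finally show ?thesis
      unfolding emeasure_scalar_spectral_measure[OF spectral_projection_pvm f B] c1(4)[OF B] c2(4)[OF B]
      by (simp add: ennreal_plus integral_nonneg_AE)
  qed
  have s: "sets N1 = sets ?N" "sets N2 = sets ?N" by (simp_all add: N1_def N2_def)
  show "integrable ?N \<phi>"
    by (rule integral_sum_measure(1)[OF s e c1(2) c2(2)])
  have "(\<integral>x. \<phi> x \<partial>?N) = (\<integral>x. \<phi> x \<partial>N1) + (\<integral>x. \<phi> x \<partial>N2)"
    by (rule integral_sum_measure(2)[OF s e c1(2) c2(2)])
  also have "\<dots> = (\<integral>x. \<phi> (v x) * (norm (Q x *v f x))\<^sup>2 + - \<phi> (v x) * (norm (f x - Q x *v f x))\<^sup>2 \<partial>M)"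
    using c1(1) c2(1) by (simp add: c1(3) c2(3) odd)
  finally show "L2_inner M f (T f) = of_real (\<integral>x. \<phi> x \<partial>?N)"
    by (simp add: diagonal_quadratic_form[OF T])
qed

lemma fst_snd_bound:
  assumes "x \<in> space M" shows "\<bar>fst (v x)\<bar> \<le> K" "\<bar>snd (v x)\<bar> \<le> K"
  using v_bounded[OF assms] norm_fst_le[of "fst (v x)" "snd (v x)"] norm_snd_le[of "snd (v x)" "fst (v x)"]
  by auto

section \<open>The joint spectrum of the pair with eigenvalues \<open>v\<close> and
  \<open>- v\<close>\<close>

context
  fixes T1 T2 :: "('a \<Rightarrow> complex ^ 'n) \<Rightarrow> ('a \<Rightarrow> complex ^ 'n)"
  assumes T1: "\<And>f x. x \<in> space M \<Longrightarrow> T1 f x = fst (v x) *\<^sub>R (Q x *v f x) - fst (v x) *\<^sub>R (f x - Q x *v f x)"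
    and T2: "\<And>f x. x \<in> space M \<Longrightarrow> T2 f x = snd (v x) *\<^sub>R (Q x *v f x) - snd (v x) *\<^sub>R (f x - Q x *v f x)"
begin

lemma diagonal_T1: "diagonal (\<lambda>x. fst (v x)) (\<lambda>x. - fst (v x)) T1"
  and diagonal_T2: "diagonal (\<lambda>x. snd (v x)) (\<lambda>x. - snd (v x)) T2"
proof -
  have m: "(\<lambda>x. fst (v x)) \<in> borel_measurable M" "(\<lambda>x. snd (v x)) \<in> borel_measurable M"
    using measurable_compose[OF v_measurable, of fst borel] measurable_compose[OF v_measurable, of snd borel]
    by (simp_all add: borel_measurable_continuous_onI continuous_intros)
  have "\<exists>C\<ge>0. \<forall>x\<in>space M. \<bar>fst (v x)\<bar> \<le> C" "\<exists>C\<ge>0. \<forall>x\<in>space M. \<bar>snd (v x)\<bar> \<le> C"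
    using fst_snd_bound by (auto intro!: exI[of _ "max K 0"] simp: le_max_iff_disj)
  with m show "diagonal (\<lambda>x. fst (v x)) (\<lambda>x. - fst (v x)) T1" "diagonal (\<lambda>x. snd (v x)) (\<lambda>x. - snd (v x)) T2"
    by (simp_all add: diagonal_def T1 T2)
qed

lemma pvm_support_joint_spectral_measure:
  assumes J: "joint_spectral_measure M T1 T2 P"
  shows "pvm_support M P = {c. joint_approx_eigenvalue M T1 T2 c}"
proof -
  note pvm = J[unfolded joint_spectral_measure_def, THEN conjunct1]
  note rep = J[unfolded joint_spectral_measure_def, THEN conjunct2, rule_format]
  have *: "spectral_integral M P \<phi> T"
    if \<phi>: "\<phi> \<in> borel_measurable borel" and T: "diagonal \<alpha> \<beta> T"
      and r: "\<And>f. f \<in> L2 M \<Longrightarrow> integrable (scalar_spectral_measure M P f) \<phi>"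
        "\<And>f. f \<in> L2 M \<Longrightarrow> L2_inner M f (T f) = of_real (\<integral>x. \<phi> x \<partial>scalar_spectral_measure M P f)"
    for \<phi> \<alpha> \<beta> T
  proof -
    note O = diagonal_operator[OF T]
    have "L2_rinner M (T f) g = L2_rinner M f (T g)" if "f \<in> L2 M" "g \<in> L2 M" for f g
      using that diagonal_symmetric[OF T, of f g] by (simp add: L2_operatorD(1)[OF O] flip: Re_L2_inner)
    moreover have "L2_rinner M f (T f) = (\<integral>x. \<phi> x \<partial>scalar_spectral_measure M P f)" if "f \<in> L2 M" for f
      using that r(2)[OF that] by (simp add: L2_operatorD(1)[OF O] flip: Re_L2_inner)
    ultimately show ?thesis
      unfolding spectral_integral_def using pvm r \<phi> O by (intro conjI ballI) simp_all
  qed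
  have "spectral_integral M P fst T1"
    by (rule *[OF _ diagonal_T1]) (use rep in \<open>auto simp: borel_measurable_continuous_onI continuous_on_fst\<close>)
  moreover have "spectral_integral M P snd T2"
    by (rule *[OF _ diagonal_T2]) (use rep in \<open>auto simp: borel_measurable_continuous_onI continuous_on_snd\<close>)
  ultimately show ?thesis by (rule pvm_support_eq)
qed

text \<open>The explicit measure shows that \<open>SOME\<close> picks a genuine joint spectral
  measure; the support formula holds for whichever one it picks.\<close>

lemma joint_spectrum_eq: "joint_spectrum M T1 T2 = {c. joint_approx_eigenvalue M T1 T2 c}"
proof -
  have m: "fst \<in> borel_measurable (borel :: (real \<times> real) measure)"
      "snd \<in> borel_measurable (borel :: (real \<times> real) measure)"
    by (simp_all add: borel_measurable_continuous_onI continuous_intros)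
  have "joint_spectral_measure M T1 T2 spectral_projection"
    unfolding joint_spectral_measure_def
    using spectral_projection_pvm spectral_projection_represents[OF diagonal_T1 m(1) _ fst_snd_bound(1)]
      spectral_projection_represents[OF diagonal_T2 m(2) _ fst_snd_bound(2)]
    by simp
  thus ?thesis
    unfolding joint_spectrum_def
    by (intro pvm_support_joint_spectral_measure someI[of "joint_spectral_measure M T1 T2"])
qed

text \<open>If \<open>c\<close> has distance at least \<open>\<delta>\<close> from \<open>C\<close>,
  the squared norms of \<open>T1 f - fst c f\<close> and \<open>T2 f - snd c f\<close> add up
  pointwise to at least \<open>\<delta>^2\<close> times that of \<open>f\<close>, which excludes
  approximate eigenvectors.\<close>

lemma joint_spectrum_subset:
  assumes C: "closed C" "\<And>x. x \<in> space M \<Longrightarrow> v x \<in> C \<and> - v x \<in> C"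
  shows "joint_spectrum M T1 T2 \<subseteq> C"
proof
  fix c assume "c \<in> joint_spectrum M T1 T2"
  hence c: "joint_approx_eigenvalue M T1 T2 c" by (simp add: joint_spectrum_eq)
  show "c \<in> C"
  proof (rule ccontr)
    assume "c \<notin> C"
    then obtain \<delta> where \<delta>: "\<delta> > 0" "\<And>y. y \<in> C \<Longrightarrow> \<delta> \<le> dist c y"
      using separate_point_closed[OF C(1)] by blast
    \<comment> \<open>An error of \<open>\<delta> / 2\<close> for each operator gives a total of
      \<open>\<delta>^2 / 2\<close>, below the lower bound \<open>\<delta>^2\<close>.\<close>
    obtain f where f: "f \<in> L2 M" "L2_norm M f > 0"
      and 1: "L2_norm M (\<lambda>x. T1 f x - fst c *\<^sub>R f x) \<le> \<delta> / 2 * L2_norm M f"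
      and 2: "L2_norm M (\<lambda>x. T2 f x - snd c *\<^sub>R f x) \<le> \<delta> / 2 * L2_norm M f"
      using c[unfolded joint_approx_eigenvalue_def, rule_format, of "\<delta> / 2"] \<delta>(1) by auto
    let ?g1 = "\<lambda>x. T1 f x - fst c *\<^sub>R f x" and ?g2 = "\<lambda>x. T2 f x - snd c *\<^sub>R f x"
    have g: "?g1 \<in> L2 M" "?g2 \<in> L2 M"
      using f(1) L2_operatorD(1)[OF diagonal_operator[OF diagonal_T1]]
        L2_operatorD(1)[OF diagonal_operator[OF diagonal_T2]] by (intro L2_diff L2_scaleR; simp)+
    have pw: "\<delta>\<^sup>2 * (norm (f x))\<^sup>2 \<le> (norm (?g1 x))\<^sup>2 + (norm (?g2 x))\<^sup>2" if x: "x \<in> space M" for x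
    proof -
      note q = hermitian_projection_norm[OF Q_projection[OF x]]
      let ?y = "Q x *v f x" and ?z = "f x - Q x *v f x"
      have "?g1 x = (fst (v x) - fst c) *\<^sub>R ?y + (- fst (v x) - fst c) *\<^sub>R ?z"
        by (simp add: T1[OF x] algebra_simps)
      hence g1: "(norm (?g1 x))\<^sup>2 = (fst (v x) - fst c)\<^sup>2 * (norm ?y)\<^sup>2 + (- fst (v x) - fst c)\<^sup>2 * (norm ?z)\<^sup>2"
        by (simp only: q)
      have "?g2 x = (snd (v x) - snd c) *\<^sub>R ?y + (- snd (v x) - snd c) *\<^sub>R ?z"
        by (simp add: T2[OF x] algebra_simps)
      hence g2: "(norm (?g2 x))\<^sup>2 = (snd (v x) - snd c)\<^sup>2 * (norm ?y)\<^sup>2 + (- snd (v x) - snd c)\<^sup>2 * (norm ?z)\<^sup>2"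
        by (simp only: q)
      have d: "\<delta>\<^sup>2 \<le> (fst y - fst c)\<^sup>2 + (snd y - snd c)\<^sup>2" if "y \<in> C" for y
      proof -
        have "\<delta>\<^sup>2 \<le> (dist c y)\<^sup>2" using \<delta>(1) \<delta>(2)[OF that] by (simp add: power_mono)
        thus ?thesis by (simp add: dist_prod_def dist_real_def power2_commute)
      qed
      have "\<delta>\<^sup>2 * (norm (f x))\<^sup>2 = \<delta>\<^sup>2 * (norm ?y)\<^sup>2 + \<delta>\<^sup>2 * (norm ?z)\<^sup>2"
        by (simp add: hermitian_projection_pythagoras[OF Q_projection[OF x], of "f x"] distrib_left)
      also have "\<dots> \<le> ((fst (v x) - fst c)\<^sup>2 + (snd (v x) - snd c)\<^sup>2) * (norm ?y)\<^sup>2 +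
          ((- fst (v x) - fst c)\<^sup>2 + (- snd (v x) - snd c)\<^sup>2) * (norm ?z)\<^sup>2"
        using d[of "v x"] d[of "- v x"] C(2)[OF x] by (intro add_mono mult_right_mono) auto
      also have "\<dots> = (norm (?g1 x))\<^sup>2 + (norm (?g2 x))\<^sup>2"
        unfolding g1 g2 distrib_right by (simp only: ac_simps)
      finally show ?thesis .
    qed
    have n: "(L2_norm M h)\<^sup>2 = (\<integral>x. (norm (h x))\<^sup>2 \<partial>M)" for h :: "'a \<Rightarrow> complex ^ 'n"
      by (simp add: L2_norm_def)
    have "\<delta>\<^sup>2 * (L2_norm M f)\<^sup>2 = (\<integral>x. \<delta>\<^sup>2 * (norm (f x))\<^sup>2 \<partial>M)"
      by (simp add: n)
    also have "\<dots> \<le> (\<integral>x. (norm (?g1 x))\<^sup>2 + (norm (?g2 x))\<^sup>2 \<partial>M)"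
      using L2_D(2)[OF f(1)] L2_D(2)[OF g(1)] L2_D(2)[OF g(2)] by (intro integral_mono pw) auto
    also have "\<dots> = (L2_norm M ?g1)\<^sup>2 + (L2_norm M ?g2)\<^sup>2"
      using L2_D(2)[OF g(1)] L2_D(2)[OF g(2)] by (simp add: n)
    also have "\<dots> \<le> (\<delta> / 2 * L2_norm M f)\<^sup>2 + (\<delta> / 2 * L2_norm M f)\<^sup>2"
      using 1 2 by (intro add_mono power_mono) auto
    also have "\<dots> = \<delta>\<^sup>2 * (L2_norm M f)\<^sup>2 / 2"
      by (simp add: power_mult_distrib power_divide)
    finally show False using \<delta>(1) f(2) by (simp add: mult_le_0_iff)
  qed
qed

text \<open>Functions supported in \<open>S\<close> with values in the range of \<open>Q\<close> are
  approximate eigenvectors. Finite measure puts them in \<open>L2\<close>; positive measure and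
  \<open>Q x \<noteq> 0\<close> provide one that does not vanish.\<close>

lemma mem_joint_spectrum:
  assumes S: "\<And>\<epsilon>. \<epsilon> > 0 \<Longrightarrow> \<exists>S\<in>sets M. 0 < emeasure M S \<and> emeasure M S < \<infinity> \<and>
    (\<forall>x\<in>S. Q x \<noteq> 0 \<and> dist (v x) c \<le> \<epsilon>)"
  shows "c \<in> joint_spectrum M T1 T2"
  unfolding joint_spectrum_eq mem_Collect_eq joint_approx_eigenvalue_def
proof (intro allI impI)
  fix \<epsilon> :: real assume \<epsilon>: "\<epsilon> > 0"
  then obtain S where S [measurable]: "S \<in> sets M" and pos: "0 < emeasure M S" and fin: "emeasure M S < \<infinity>"
    and QS: "\<And>x. x \<in> S \<Longrightarrow> Q x \<noteq> 0" and dS: "\<And>x. x \<in> S \<Longrightarrow> dist (v x) c \<le> \<epsilon>"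
    using S by blast
  \<comment> \<open>Some coordinate vector has a nonzero image under \<open>Q x\<close>, but its
    index may depend on \<open>x\<close>. If every \<open>g i\<close> vanished almost everywhere, so
    would \<open>Q\<close> on \<open>S\<close>; hence a single index works.\<close>
  define h :: "'n \<Rightarrow> 'a \<Rightarrow> complex ^ 'n" where "h i x = indicator S x *\<^sub>R axis i 1" for i x
  define g where "g i x = Q x *v h i x" for i x
  have h: "h i \<in> L2 M" for i
  proof -
    have "integrable M (\<lambda>x. indicator S x :: real)" using S fin by simp
    moreover have "(norm (h i x))\<^sup>2 = indicator S x" for x by (simp add: h_def indicator_def)
    moreover have "h i \<in> borel_measurable M" unfolding h_def by measurable
    ultimately show ?thesis by (simp add: L2_def)
  qed
  have g: "g i \<in> L2 M" for i unfolding g_def by (rule Q_L2(1)[OF h])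
  have "\<exists>i. L2_norm M (g i) \<noteq> 0"
  proof (rule ccontr)
    assume "\<not> ?thesis"
    hence "AE x in M. \<forall>i. g i x = 0"
      using L2_norm_eq_0_iff[OF g] by (simp add: L2_eq_def AE_all_countable)
    hence "AE x in M. x \<notin> S"
    proof eventually_elim
      fix x assume 0: "\<forall>i. g i x = 0"
      show "x \<notin> S"
      proof
        assume "x \<in> S"
        hence "(Q x *v axis i 1) $ j = 0" for i j using 0 by (simp add: g_def h_def)
        hence "Q x = 0"
          by (simp add: vec_eq_iff matrix_vector_mult_def axis_def if_distrib cong: if_cong)
        thus False using QS[OF \<open>x \<in> S\<close>] by simp
      qed
    qed
    hence "emeasure M S = 0" using AE_iff_null_sets[OF S] by (auto dest: null_setsD1)
    thus False using pos by simp
  qed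
  then obtain i where "L2_norm M (g i) \<noteq> 0" by blast
  hence i: "L2_norm M (g i) > 0" using L2_norm_nonneg[of M "g i"] by linarith
  have Qg: "Q x *v g i x = g i x" if "x \<in> space M" for x
    unfolding g_def by (rule hermitian_projection_idem[OF Q_projection[OF that]])
  have out: "g i x = 0" if "x \<notin> S" for x using that by (simp add: g_def h_def)
  have bound: "norm (t *\<^sub>R g i x - s *\<^sub>R g i x) \<le> \<epsilon> * norm (g i x)" if "x \<in> S \<Longrightarrow> \<bar>t - s\<bar> \<le> \<epsilon>" for t s x
  proof (cases "x \<in> S")
    case True
    thus ?thesis using that by (simp add: mult_right_mono flip: scaleR_left_diff_distrib)
  qed (simp add: out)
  have g1: "(\<lambda>x. T1 (g i) x - fst c *\<^sub>R g i x) \<in> borel_measurable M"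
    using diagonal_measurable[OF diagonal_T1 g] L2_D(1)[OF g, of i] by measurable
  have g2: "(\<lambda>x. T2 (g i) x - snd c *\<^sub>R g i x) \<in> borel_measurable M"
    using diagonal_measurable[OF diagonal_T2 g] L2_D(1)[OF g, of i] by measurable
  have "L2_norm M (\<lambda>x. T1 (g i) x - fst c *\<^sub>R g i x) \<le> \<epsilon> * L2_norm M (g i)"
  proof (rule L2_norm_mono[OF g1 g])
    fix x assume x: "x \<in> space M"
    show "norm (T1 (g i) x - fst c *\<^sub>R g i x) \<le> \<epsilon> * norm (g i x)"
      using dS[of x] dist_fst_le[of "v x" c] by (auto simp: T1[OF x] Qg[OF x] dist_real_def intro!: bound)
  qed (use \<epsilon> in simp)
  moreover have "L2_norm M (\<lambda>x. T2 (g i) x - snd c *\<^sub>R g i x) \<le> \<epsilon> * L2_norm M (g i)"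
  proof (rule L2_norm_mono[OF g2 g])
    fix x assume x: "x \<in> space M"
    show "norm (T2 (g i) x - snd c *\<^sub>R g i x) \<le> \<epsilon> * norm (g i x)"
      using dS[of x] dist_snd_le[of "v x" c] by (auto simp: T2[OF x] Qg[OF x] dist_real_def intro!: bound)
  qed (use \<epsilon> in simp)
  ultimately show "\<exists>f\<in>L2 M. L2_norm M f > 0 \<and>
      L2_norm M (\<lambda>x. T1 f x - fst c *\<^sub>R f x) \<le> \<epsilon> * L2_norm M f \<and>
      L2_norm M (\<lambda>x. T2 f x - snd c *\<^sub>R f x) \<le> \<epsilon> * L2_norm M f"
    using g i by blast
qed

end

end

end


section \<open>The image of the velocities\<close>

text \<open>
  Put \<open>\<tau> = x + y\<close> with \<open>x = a cos l\<^sub>1\<close> and \<open>y = - b cos l\<^sub>2\<close>, and let \<open>X, Y\<close> be the squares of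
  \<open>(v\<^sub>1 + v\<^sub>2) / 2\<close> and \<open>(v\<^sub>1 - v\<^sub>2) / 2\<close>.  Eliminating \<open>x\<close> and \<open>y\<close> leaves a quadratic equation for
  \<open>T = \<tau>\<^sup>2\<close> whose roots are \<open>(E\<^sup>2 + (\<surd>P \<plusminus> \<surd>P')\<^sup>2) / L\<close>; here \<open>P, P' \<ge> 0\<close> are the equations of the
  two ellipses and \<open>1 - T = (F\<^sup>2 + (\<surd>P \<mp> \<surd>P')\<^sup>2) / L\<close>.
\<close>

lemma velocity_preimage:
  fixes \<alpha> \<beta> \<alpha>' \<beta>' X Y :: real
  assumes sum: "\<alpha> + \<beta> = 1" "\<alpha>' + \<beta>' = 1"
  defines "P \<equiv> \<alpha> * \<beta> - \<beta> * X - \<alpha> * Y" and "P' \<equiv> \<alpha>' * \<beta>' - \<beta>' * X - \<alpha>' * Y"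
  assumes P: "P \<ge> 0" "P' \<ge> 0" and pos: "(\<alpha> - \<alpha>')\<^sup>2 + P + P' > 0"
  shows "\<exists>x y. (x + y)\<^sup>2 < 1 \<and> x\<^sup>2 = \<alpha> * \<alpha>' - X * (1 - (x + y)\<^sup>2) \<and> y\<^sup>2 = \<beta> * \<beta>' - Y * (1 - (x + y)\<^sup>2)"
proof -
  define E where "E = \<alpha> * \<alpha>' - \<beta> * \<beta>' - X + Y"
  define F where "F = \<alpha> - \<alpha>'"
  define L where "L = E\<^sup>2 + F\<^sup>2 + 2 * P + 2 * P'"
  define r where "r = sqrt P * sqrt P'"
  have r2: "r\<^sup>2 = P * P'" using P by (simp add: r_def power_mult_distrib)
  \<comment> \<open>The smaller root is taken: \<open>L (1 - T)\<close> then contains the square of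
    \<open>sqrt P + sqrt P'\<close>, and \<open>pos\<close> yields \<open>T < 1\<close>.\<close>
  define T where "T = (E\<^sup>2 + (sqrt P - sqrt P')\<^sup>2) / L"
  have L: "L > 0"
  proof -
    have "0 \<le> E\<^sup>2" by simp
    thus ?thesis using P pos unfolding L_def F_def by linarith
  qed
  have T_eq: "L * T = E\<^sup>2 + P + P' - 2 * r"
    using L P by (simp add: T_def power2_diff r_def)
  have T0: "T \<ge> 0" using L by (simp add: T_def)
  have "L * (1 - T) = F\<^sup>2 + (sqrt P + sqrt P')\<^sup>2"
    using T_eq P by (simp add: right_diff_distrib power2_sum r_def) (simp add: L_def)
  moreover have "F\<^sup>2 + (sqrt P + sqrt P')\<^sup>2 \<ge> F\<^sup>2 + P + P'"
    using P by (simp add: power2_sum)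
  ultimately have "L * (1 - T) > 0" using pos by (simp add: F_def)
  hence T1: "T < 1" using L by (simp add: zero_less_mult_iff)
  define D where "D = X - Y"
  define A where "A = \<alpha> * \<alpha>' - \<beta> * \<beta>'"
  have \<beta>: "\<beta> = 1 - \<alpha>" "\<beta>' = 1 - \<alpha>'" using sum by simp_all
  have Ls: "L = 1 + D\<^sup>2 - 2 * (X + Y)"
    unfolding L_def E_def F_def P_def P'_def D_def \<beta> by (simp add: power2_eq_square algebra_simps)
  have lin: "2 * (D * E - (\<alpha> * \<alpha>' + \<beta> * \<beta>' - X - Y)) = - 2 * (E\<^sup>2 + P + P')"
    unfolding E_def P_def P'_def D_def \<beta> by (simp add: power2_eq_square algebra_simps)
  \<comment> \<open>The quarter discriminant of \<open>L T^2 - 2 (E^2 + P + P') T + E^2\<close> is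
    \<open>4 P P'\<close>.\<close>
  have disc: "(E\<^sup>2 + P + P')\<^sup>2 - 4 * (P * P') = L * E\<^sup>2"
    unfolding L_def E_def F_def P_def P'_def \<beta> by (simp add: power2_eq_square algebra_simps)
  have "L * (L * T\<^sup>2 - 2 * (E\<^sup>2 + P + P') * T + E\<^sup>2) = (L * T - (E\<^sup>2 + P + P'))\<^sup>2 - 4 * (P * P')"
    using disc by (simp add: power2_eq_square algebra_simps)
  also have "\<dots> = 0" using r2 by (simp add: T_eq power_mult_distrib)
  finally have "L * T\<^sup>2 - 2 * (E\<^sup>2 + P + P') * T + E\<^sup>2 = 0" using L by simp
  \<comment> \<open>With \<open>t = x + y\<close>, \<open>d = x - y\<close> and
    \<open>T = t^2\<close> this reads \<open>t^4 + (t d)^2 = 2 t^2 (x^2 + y^2)\<close>, where the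
    two required equations express \<open>t d = x^2 - y^2\<close> and \<open>x^2 + y^2\<close>
    through \<open>T\<close>.\<close>
  hence quad: "T\<^sup>2 + (A - D * (1 - T))\<^sup>2 = 2 * T * (\<alpha> * \<alpha>' + \<beta> * \<beta>' - (X + Y) * (1 - T))"
    using lin unfolding Ls A_def E_def D_def by algebra
  show ?thesis
  proof (cases "T = 0")
    \<comment> \<open>Here \<open>d\<close> would need a division by \<open>t = 0\<close>. But
      \<open>E = 0\<close> and \<open>P = P'\<close> make both required squares equal to
      \<open>P\<close>, so \<open>y = - x\<close> solves the problem.\<close>
    case True
    with quad have "A = D" by simp
    hence E0: "E = 0" by (simp add: E_def A_def D_def)
    hence "(sqrt P - sqrt P')\<^sup>2 = 0" using True L by (simp add: T_def)
    hence "P = P'" using P by simp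
    have "P = \<alpha> * \<alpha>' - X"
      using E0 unfolding E_def P_def \<beta> by algebra
    hence X: "\<alpha> * \<alpha>' - X \<ge> 0" using P by simp
    have Y: "\<beta> * \<beta>' - Y = \<alpha> * \<alpha>' - X" using E0 by (simp add: E_def)
    show ?thesis
      by (rule exI[of _ "sqrt (\<alpha> * \<alpha>' - X)"], rule exI[of _ "- sqrt (\<alpha> * \<alpha>' - X)"]) (use X Y in simp)
  next
    case False
    define t where "t = sqrt T"
    have t: "t > 0" "t\<^sup>2 = T" using False T0 by (simp_all add: t_def)
    define d where "d = (A - D * (1 - T)) / t"
    have td: "t * d = A - D * (1 - T)" using t by (simp add: d_def)
    have "T * (T + d\<^sup>2) = T\<^sup>2 + (t * d)\<^sup>2"
      by (simp add: power_mult_distrib t(2) power2_eq_square[of T] distrib_left)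
    also have "\<dots> = T * (2 * (\<alpha> * \<alpha>' + \<beta> * \<beta>' - (X + Y) * (1 - T)))"
      using quad by (simp add: td)
    finally have sq: "T + d\<^sup>2 = 2 * (\<alpha> * \<alpha>' + \<beta> * \<beta>' - (X + Y) * (1 - T))"
      using False by simp
    define x where "x = (t + d) / 2"
    define y where "y = (t - d) / 2"
    have xy: "x + y = t" by (simp add: x_def y_def field_simps)
    have "4 * x\<^sup>2 = (T + d\<^sup>2) + 2 * (t * d)" "4 * y\<^sup>2 = (T + d\<^sup>2) - 2 * (t * d)"
      by (simp_all add: x_def y_def power_divide power2_sum power2_diff t(2))
    hence "x\<^sup>2 = \<alpha> * \<alpha>' - X * (1 - T)" "y\<^sup>2 = \<beta> * \<beta>' - Y * (1 - T)"
      unfolding sq td A_def D_def by (simp_all add: algebra_simps)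
    thus ?thesis using T1 xy t by blast
  qed
qed

section \<open>Ellipses and the velocity map\<close>

lemma co_properties:
  assumes "x \<in> {0..1}"
  shows "(co x)\<^sup>2 = 1 - x\<^sup>2" "co x \<ge> 0"
proof -
  have "x\<^sup>2 \<le> 1" using assms by (simp add: power_le_one)
  thus "(co x)\<^sup>2 = 1 - x\<^sup>2" "co x \<ge> 0" by (simp_all add: co_def)
qed

definition velocity :: "real \<Rightarrow> real \<Rightarrow> real \<times> real \<Rightarrow> real \<times> real" where
  "velocity a1 a2 k = (vel1 a1 a2 k, vel2 a1 a2 k)"

text \<open>A function besides the set, because strict inequality and homogeneity under scaling are
  needed to approach boundary points from inside.\<close>

definition ellipse_form :: "real \<Rightarrow> real \<Rightarrow> real \<times> real \<Rightarrow> real" where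
  "ellipse_form \<alpha> \<beta> v = (fst v + snd v)\<^sup>2 / (4 * \<alpha>) + (fst v - snd v)\<^sup>2 / (4 * \<beta>)"

lemma ellipse_eq: "ellipse \<alpha> \<beta> = {v. ellipse_form \<alpha> \<beta> v \<le> 1}"
  by (auto simp: ellipse_def ellipse_form_def)

lemma closed_ellipse: "closed (ellipse \<alpha> \<beta>)"
  unfolding ellipse_eq ellipse_form_def divide_inverse
  by (intro closed_Collect_le continuous_intros)

lemma ellipse_form_scaleR: "ellipse_form \<alpha> \<beta> (c *\<^sub>R v) = c\<^sup>2 * ellipse_form \<alpha> \<beta> v"
proof -
  have "fst (c *\<^sub>R v) + snd (c *\<^sub>R v) = c * (fst v + snd v)" "fst (c *\<^sub>R v) - snd (c *\<^sub>R v) = c * (fst v - snd v)"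
    by (simp_all add: algebra_simps)
  thus ?thesis
    unfolding ellipse_form_def by (simp add: power_mult_distrib) (simp add: distrib_left)
qed

lemma ellipse_uminus: "v \<in> ellipse \<alpha> \<beta> \<Longrightarrow> - v \<in> ellipse \<alpha> \<beta>"
  using ellipse_form_scaleR[of \<alpha> \<beta> "-1" v] by (simp add: ellipse_eq)

locale walk_parameters =
  fixes a1 a2 a b :: real
  assumes a1: "a1 \<in> {0..1}" and a2: "a2 \<in> {0..1}"
    and a_eq: "a = a1 * a2" and b_eq: "b = co a1 * co a2"
    and a_pos: "a > 0" and b_pos: "b > 0"
begin

lemma pos: "a1 > 0" "a2 > 0" "co a1 > 0" "co a2 > 0"
  using a_pos b_pos a1 a2 co_properties(2)[OF a1] co_properties(2)[OF a2]
  by (auto simp: a_eq b_eq zero_less_mult_iff)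

lemma squares: "a1\<^sup>2 + (co a1)\<^sup>2 = 1" "a2\<^sup>2 + (co a2)\<^sup>2 = 1"
  "a\<^sup>2 = a1\<^sup>2 * a2\<^sup>2" "b\<^sup>2 = (co a1)\<^sup>2 * (co a2)\<^sup>2"
  using co_properties(1)[OF a1] co_properties(1)[OF a2] by (simp_all add: a_eq b_eq power_mult_distrib)

text \<open>The defect \<open>1 - (a + b)^2\<close> is a square; in terms of the coin angles it is
  the squared sine of their difference.\<close>

lemma sum_le_1: "(a + b)\<^sup>2 \<le> 1" "a + b \<le> 1"
proof -
  have "1 - (a + b)\<^sup>2 = (a1 * co a2 - a2 * co a1)\<^sup>2"
    using squares(1,2) unfolding a_eq b_eq by algebra
  thus "(a + b)\<^sup>2 \<le> 1" by (metis diff_ge_0_iff_ge zero_le_power2)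
  thus "a + b \<le> 1" using power2_le_imp_le[of "a + b" 1] by simp
qed

lemma tau_eq: "tau a1 a2 k = a * cos (l1 k) - b * cos (l2 k)"
  by (simp add: tau_def a_eq b_eq)

lemma tau_bound: "\<bar>tau a1 a2 k\<bar> \<le> 1"
proof -
  have "\<bar>a * cos (l1 k)\<bar> \<le> a" "\<bar>b * cos (l2 k)\<bar> \<le> b"
    using a_pos b_pos by (simp_all add: abs_mult mult_left_le)
  thus ?thesis using sum_le_1(2) unfolding tau_eq by linarith
qed

lemma tau_sq_le: "(tau a1 a2 k)\<^sup>2 \<le> 1"
  using tau_bound by (simp add: abs_square_le_1)

text \<open>Where \<open>\<tau>\<^sup>2 = 1\<close> both sides are \<open>0\<close>, by division by zero.\<close>

lemma velocity_sum: "fst (velocity a1 a2 k) + snd (velocity a1 a2 k) = - 2 * (a * sin (l1 k) / sqrt (1 - (tau a1 a2 k)\<^sup>2))"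
    and velocity_difference: "fst (velocity a1 a2 k) - snd (velocity a1 a2 k) = - 2 * (b * sin (l2 k) / sqrt (1 - (tau a1 a2 k)\<^sup>2))"
  by (simp_all add: velocity_def vel1_def vel2_def a_eq b_eq add_divide_distrib diff_divide_distrib)

lemma ellipse_form_velocity:
  assumes "(tau a1 a2 k)\<^sup>2 \<noteq> 1" "\<alpha> > 0" "\<beta> > 0"
  shows "ellipse_form \<alpha> \<beta> (velocity a1 a2 k) =
    ((a * sin (l1 k))\<^sup>2 / \<alpha> + (b * sin (l2 k))\<^sup>2 / \<beta>) / (1 - (tau a1 a2 k)\<^sup>2)"
  using tau_sq_le[of k] assms
  unfolding ellipse_form_def velocity_sum velocity_difference
  by (simp add: power_divide power_mult_distrib add_divide_distrib mult.commute)

text \<open>With \<open>x = a cos l1\<close> and \<open>y = - b cos l2\<close> the claim becomes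
  \<open>(x + y)^2 \<le> x^2 / \<alpha> + y^2 / \<beta>\<close>, which is Cauchy-Schwarz for weights
  of sum 1. One coin supplies \<open>\<alpha>\<close>, \<open>\<beta>\<close> and the other
  \<open>\<alpha>'\<close>, \<open>\<beta>'\<close>; exchanging the coins gives the second
  ellipse.\<close>

lemma velocity_in_ellipse:
  assumes \<alpha>: "\<alpha> > 0" "\<beta> > 0" "\<alpha> + \<beta> = 1" and a: "a\<^sup>2 = \<alpha> * \<alpha>'" and b: "b\<^sup>2 = \<beta> * \<beta>'" and s: "\<alpha>' + \<beta>' = 1"
  shows "velocity a1 a2 k \<in> ellipse \<alpha> \<beta>"
proof (cases "(tau a1 a2 k)\<^sup>2 = 1")
  \<comment> \<open>The default velocity 0 has to be covered too, since the upper bound for the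
    joint spectrum is asked for at every point of the torus.\<close>
  case True
  hence "velocity a1 a2 k = (0, 0)" by (simp add: velocity_def vel1_def vel2_def)
  thus ?thesis by (simp add: ellipse_def)
next
  case False
  define x where "x = a * cos (l1 k)"
  define y where "y = - (b * cos (l2 k))"
  have \<tau>: "tau a1 a2 k = x + y" by (simp add: tau_eq x_def y_def)
  have sx: "(a * sin (l1 k))\<^sup>2 = \<alpha> * \<alpha>' - x\<^sup>2"
    by (simp add: x_def power_mult_distrib sin_squared_eq a right_diff_distrib)
  have sy: "(b * sin (l2 k))\<^sup>2 = \<beta> * \<beta>' - y\<^sup>2"
    by (simp add: y_def power_mult_distrib sin_squared_eq b right_diff_distrib)
  have "(x + y)\<^sup>2 \<le> x\<^sup>2 / \<alpha> + y\<^sup>2 / \<beta>"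
  proof -
    have "\<alpha> * \<beta> * (x\<^sup>2 / \<alpha> + y\<^sup>2 / \<beta> - (x + y)\<^sup>2) = \<beta> * x\<^sup>2 + \<alpha> * y\<^sup>2 - \<alpha> * \<beta> * (x + y)\<^sup>2"
      using \<alpha> by (simp add: field_simps)
    also have "\<dots> = (\<beta> * x - \<alpha> * y)\<^sup>2"
      using \<alpha>(3) by algebra
    finally have "0 \<le> \<alpha> * \<beta> * (x\<^sup>2 / \<alpha> + y\<^sup>2 / \<beta> - (x + y)\<^sup>2)" by simp
    hence "\<not> x\<^sup>2 / \<alpha> + y\<^sup>2 / \<beta> - (x + y)\<^sup>2 < 0"
      using mult_pos_neg[OF mult_pos_pos[OF \<alpha>(1,2)]] not_less by blast
    thus ?thesis by simp
  qed
  hence "(\<alpha> * \<alpha>' - x\<^sup>2) / \<alpha> + (\<beta> * \<beta>' - y\<^sup>2) / \<beta> \<le> 1 - (x + y)\<^sup>2"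
    using \<alpha> s by (simp add: diff_divide_distrib)
  moreover have "1 - (x + y)\<^sup>2 > 0" using False tau_sq_le[of k] by (simp add: \<tau>)
  ultimately have "ellipse_form \<alpha> \<beta> (velocity a1 a2 k) \<le> 1"
    unfolding ellipse_form_velocity[OF False \<alpha>(1,2)] sx sy \<tau> by simp
  thus ?thesis by (simp add: ellipse_eq)
qed

text \<open>\<open>strict\<close> supplies the positivity hypothesis of
  \<open>velocity_preimage\<close>, which for points of both ellipses fails only if the coins are
  equal and \<open>v\<close> lies on the boundary curve.\<close>

lemma velocity_surj:
  assumes le: "v \<in> ellipse (a1\<^sup>2) ((co a1)\<^sup>2)" "v \<in> ellipse (a2\<^sup>2) ((co a2)\<^sup>2)"
    and strict: "a1 \<noteq> a2 \<or> ellipse_form (a1\<^sup>2) ((co a1)\<^sup>2) v < 1"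
  shows "\<exists>k. (tau a1 a2 k)\<^sup>2 \<noteq> 1 \<and> velocity a1 a2 k = v"
proof -
  define p where "p = (fst v + snd v) / 2"
  define q where "q = (fst v - snd v) / 2"
  \<comment> \<open>Clearing denominators turns the ellipse inequality into \<open>P \<ge> 0\<close>
    for the quadratic problem with \<open>X = p^2\<close> and \<open>Y = q^2\<close>.\<close>
  have form: "\<alpha> * \<beta> * (1 - ellipse_form \<alpha> \<beta> v) = \<alpha> * \<beta> - \<beta> * p\<^sup>2 - \<alpha> * q\<^sup>2" if "\<alpha> > 0" "\<beta> > 0" for \<alpha> \<beta>
    using that by (simp add: ellipse_form_def p_def q_def field_simps)
  have P: "a1\<^sup>2 * (co a1)\<^sup>2 - (co a1)\<^sup>2 * p\<^sup>2 - a1\<^sup>2 * q\<^sup>2 \<ge> 0" "a2\<^sup>2 * (co a2)\<^sup>2 - (co a2)\<^sup>2 * p\<^sup>2 - a2\<^sup>2 * q\<^sup>2 \<ge> 0"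
    using le pos by (simp_all add: ellipse_eq flip: form)
  have pos': "(a1\<^sup>2 - a2\<^sup>2)\<^sup>2 + (a1\<^sup>2 * (co a1)\<^sup>2 - (co a1)\<^sup>2 * p\<^sup>2 - a1\<^sup>2 * q\<^sup>2) +
      (a2\<^sup>2 * (co a2)\<^sup>2 - (co a2)\<^sup>2 * p\<^sup>2 - a2\<^sup>2 * q\<^sup>2) > 0"
    using strict
  proof
    assume "a1 \<noteq> a2"
    hence "a1\<^sup>2 \<noteq> a2\<^sup>2" using pos by (simp add: power2_eq_iff_nonneg)
    hence "(a1\<^sup>2 - a2\<^sup>2)\<^sup>2 > 0" by simp
    thus ?thesis using P by linarith
  next
    assume "ellipse_form (a1\<^sup>2) ((co a1)\<^sup>2) v < 1"
    hence "a1\<^sup>2 * (co a1)\<^sup>2 - (co a1)\<^sup>2 * p\<^sup>2 - a1\<^sup>2 * q\<^sup>2 > 0" using pos by (simp flip: form)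
    moreover have "(a1\<^sup>2 - a2\<^sup>2)\<^sup>2 \<ge> 0" by simp
    ultimately show ?thesis using P by linarith
  qed
  obtain x y where xy: "(x + y)\<^sup>2 < 1" and x: "x\<^sup>2 = a\<^sup>2 - p\<^sup>2 * (1 - (x + y)\<^sup>2)" and y: "y\<^sup>2 = b\<^sup>2 - q\<^sup>2 * (1 - (x + y)\<^sup>2)"
    using velocity_preimage[OF squares(1,2) P pos'] by (auto simp: squares(3,4))
  define s where "s = sqrt (1 - (x + y)\<^sup>2)"
  have s: "s > 0" "s\<^sup>2 = 1 - (x + y)\<^sup>2" using xy by (simp_all add: s_def)
  \<comment> \<open>The cosines are prescribed by \<open>x\<close>, \<open>y\<close> and the sines
    by \<open>p\<close>, \<open>q\<close>; the equations for \<open>x^2\<close> and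
    \<open>y^2\<close> say exactly that these values lie on the unit circle.\<close>
  have "(x / a)\<^sup>2 + (- (p * s) / a)\<^sup>2 = (x\<^sup>2 + p\<^sup>2 * s\<^sup>2) / a\<^sup>2"
    by (simp add: power_divide power_mult_distrib add_divide_distrib)
  also have "\<dots> = 1" using x a_pos by (simp add: s(2))
  finally obtain \<theta>1 where \<theta>1: "x / a = cos \<theta>1" "- (p * s) / a = sin \<theta>1"
    using sincos_total_2pi by metis
  have "(- y / b)\<^sup>2 + (- (q * s) / b)\<^sup>2 = (y\<^sup>2 + q\<^sup>2 * s\<^sup>2) / b\<^sup>2"
    by (simp add: power_divide power_mult_distrib add_divide_distrib)
  also have "\<dots> = 1" using y b_pos by (simp add: s(2))
  finally obtain \<theta>2 where \<theta>2: "- y / b = cos \<theta>2" "- (q * s) / b = sin \<theta>2"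
    using sincos_total_2pi by metis
  \<comment> \<open>The inverse of the linear change to \<open>l1\<close>, \<open>l2\<close>. The
    point may lie anywhere in the plane; periodicity moves it into the torus later.\<close>
  define k where "k = ((\<theta>1 - \<theta>2) / 2, (\<theta>1 + \<theta>2) / 2)"
  have l: "l1 k = \<theta>1" "l2 k = \<theta>2" by (simp_all add: l1_def l2_def k_def field_simps)
  have \<tau>: "tau a1 a2 k = x + y"
    using a_pos b_pos by (simp add: tau_eq l flip: \<theta>1 \<theta>2)
  have vs: "fst (velocity a1 a2 k) + snd (velocity a1 a2 k) = 2 * p"
    unfolding velocity_sum using s a_pos by (simp add: \<tau> l flip: \<theta>1 s_def)
  have vd: "fst (velocity a1 a2 k) - snd (velocity a1 a2 k) = 2 * q"
    unfolding velocity_difference using s b_pos by (simp add: \<tau> l flip: \<theta>2 s_def)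
  have "velocity a1 a2 k = v"
    using vs vd by (intro prod_eqI) (simp_all add: p_def q_def)
  thus ?thesis using \<tau> xy by (intro exI[of _ k]) simp
qed

text \<open>By the square identity, \<open>a + b = 1\<close> says that the sine of the difference of
  the coin angles vanishes.\<close>

lemma sum_lt_1_iff: "a + b < 1 \<longleftrightarrow> a1 \<noteq> a2"
proof -
  have *: "1 - (a + b)\<^sup>2 = (a1 * co a2 - a2 * co a1)\<^sup>2"
    using squares(1,2) unfolding a_eq b_eq by algebra
  have "a + b < 1 \<longleftrightarrow> (a + b)\<^sup>2 \<noteq> 1"
    using sum_le_1(2) a_pos b_pos by (simp add: power2_eq_1_iff) linarith
  also have "\<dots> \<longleftrightarrow> a1 * co a2 \<noteq> a2 * co a1"
    using * by auto
  also have "\<dots> \<longleftrightarrow> a1 \<noteq> a2"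
  proof -
    have "a1 = a2" if "a1 * co a2 = a2 * co a1"
    proof -
      have "(a1 * co a2)\<^sup>2 = (a2 * co a1)\<^sup>2" using that by simp
      hence "a1\<^sup>2 * (co a2)\<^sup>2 = a2\<^sup>2 * (co a1)\<^sup>2" by (simp add: power_mult_distrib)
      hence "a1\<^sup>2 = a2\<^sup>2" using squares(1,2) by algebra
      thus ?thesis using pos by (simp add: power2_eq_iff_nonneg)
    qed
    thus ?thesis by auto
  qed
  finally show ?thesis .
qed

lemma velocity_in_ellipses:
  "velocity a1 a2 k \<in> ellipse (a1\<^sup>2) ((co a1)\<^sup>2) \<inter> ellipse (a2\<^sup>2) ((co a2)\<^sup>2)"
  using velocity_in_ellipse[of "a1\<^sup>2" "(co a1)\<^sup>2" "a2\<^sup>2" "(co a2)\<^sup>2" k]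
    velocity_in_ellipse[of "a2\<^sup>2" "(co a2)\<^sup>2" "a1\<^sup>2" "(co a1)\<^sup>2" k] pos squares
  by (simp add: mult.commute)

text \<open>For equal coins \<open>velocity_surj\<close> reaches interior points only; every other
  point is the limit of its multiples by factors \<open>c n < 1\<close>, which are interior by
  homogeneity.\<close>

lemma ellipses_subset_closure:
  "ellipse (a1\<^sup>2) ((co a1)\<^sup>2) \<inter> ellipse (a2\<^sup>2) ((co a2)\<^sup>2) \<subseteq>
     closure (velocity a1 a2 ` {k. (tau a1 a2 k)\<^sup>2 \<noteq> 1})"
proof
  fix v assume v: "v \<in> ellipse (a1\<^sup>2) ((co a1)\<^sup>2) \<inter> ellipse (a2\<^sup>2) ((co a2)\<^sup>2)"
  let ?R = "velocity a1 a2 ` {k. (tau a1 a2 k)\<^sup>2 \<noteq> 1}"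
  show "v \<in> closure ?R"
  proof (cases "a1 = a2")
    case False
    then obtain k where "(tau a1 a2 k)\<^sup>2 \<noteq> 1" "velocity a1 a2 k = v"
      using velocity_surj[of v] v by blast
    hence "v \<in> ?R" by auto
    thus ?thesis by (rule subsetD[OF closure_subset])
  next
    case True
    define c where "c n = 1 - inverse (real (Suc (Suc n)))" for n
    have c: "0 \<le> c n" "c n < 1" for n by (simp_all add: c_def field_simps)
    have "c n *\<^sub>R v \<in> ?R" for n
    proof -
      have f: "ellipse_form (a1\<^sup>2) ((co a1)\<^sup>2) v \<le> 1" using v by (simp add: ellipse_eq)
      have c1: "(c n)\<^sup>2 < 1" using c[of n] by (simp add: power_less_one_iff abs_square_less_1)
      have "(c n)\<^sup>2 * ellipse_form (a1\<^sup>2) ((co a1)\<^sup>2) v \<le> (c n)\<^sup>2 * 1"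
        using f by (intro mult_left_mono) auto
      hence "ellipse_form (a1\<^sup>2) ((co a1)\<^sup>2) (c n *\<^sub>R v) < 1"
        using c1 by (simp add: ellipse_form_scaleR)
      then obtain k where "(tau a1 a2 k)\<^sup>2 \<noteq> 1" "velocity a1 a2 k = c n *\<^sub>R v"
        using velocity_surj[of "c n *\<^sub>R v"] True by (auto simp: ellipse_eq)
      thus ?thesis by (intro image_eqI[of _ _ k]) simp_all
    qed
    moreover have "(\<lambda>n. c n *\<^sub>R v) \<longlonglongrightarrow> (1 - 0) *\<^sub>R v"
      unfolding c_def
      by (rule tendsto_scaleR[OF tendsto_diff[OF tendsto_const LIMSEQ_Suc[OF LIMSEQ_inverse_real_of_nat]] tendsto_const])
    ultimately show ?thesis
      unfolding closure_sequential by (intro exI[of _ "\<lambda>n. c n *\<^sub>R v"]) simp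
  qed
qed

end


section \<open>The walk in momentum space\<close>

lemma borel_measurable_vecI:
  fixes f :: "'a \<Rightarrow> ('b :: euclidean_space) ^ 'n"
  assumes "\<And>i. (\<lambda>x. f x $ i) \<in> borel_measurable M"
  shows "f \<in> borel_measurable M"
  unfolding borel_measurable_euclidean_space[of f]
proof
  fix e :: "'b ^ 'n" assume "e \<in> Basis"
  then obtain i u where "e = axis i u" by (auto simp: Basis_vec_def)
  thus "(\<lambda>x. f x \<bullet> e) \<in> borel_measurable M"
    using assms[of i] by (simp add: inner_axis)
qed

lemma borel_measurable_torus:
  assumes "f \<in> borel_measurable (borel :: (real \<times> real) measure)"
  shows "f \<in> borel_measurable torus_measure"
proof -
  have "f \<in> borel_measurable lborel" using assms by simp
  thus ?thesis by (intro measurable_restrict_space1 measurable_completion)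
qed

lemma continuous_on_walk: "continuous_on UNIV (\<lambda>k. walk a1 a2 k $ i $ j)"
proof -
  have "\<forall>i j. continuous_on UNIV (\<lambda>k. walk a1 a2 k $ i $ j)"
    unfolding forall_2 walk_def matrix_matrix_mult_def shift_def coin_def
    by (simp add: sum_2 vector_2) (intro conjI continuous_intros)
  thus ?thesis by blast
qed

lemma borel_measurable_l [measurable]: "l1 \<in> borel_measurable borel" "l2 \<in> borel_measurable borel"
  unfolding l1_def l2_def by (intro borel_measurable_continuous_onI continuous_intros)+

lemma borel_measurable_tau [measurable]: "tau a1 a2 \<in> borel_measurable borel"
  unfolding tau_def by measurable

lemma borel_measurable_velocity: "velocity a1 a2 \<in> borel_measurable borel"
  unfolding velocity_def vel1_def vel2_def by (intro borel_measurable_Pair) measurable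

text \<open>Given entrywise so that measurability can be checked per entry. The value 0 at
  coinciding eigenvalues is still a hermitian projection, so the locale applies at every
  point.\<close>

definition walk_projection :: "real \<Rightarrow> real \<Rightarrow> real \<times> real \<Rightarrow> complex ^ 2 ^ 2" where
  "walk_projection a1 a2 k = (\<chi> i j. if (tau a1 a2 k)\<^sup>2 = 1 then 0 else
     (mat 1 $ i $ j + (walk a1 a2 k $ i $ j - of_real (tau a1 a2 k) * mat 1 $ i $ j) /
       (\<i> * of_real (sqrt (1 - (tau a1 a2 k)\<^sup>2)))) / 2)"

lemma borel_measurable_walk_projection: "walk_projection a1 a2 \<in> borel_measurable torus_measure"
proof (rule borel_measurable_torus, intro borel_measurable_vecI)
  fix i j
  have [measurable]: "(\<lambda>k. walk a1 a2 k $ i $ j) \<in> borel_measurable borel"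
    by (rule borel_measurable_continuous_onI[OF continuous_on_walk])
  show "(\<lambda>k. walk_projection a1 a2 k $ i $ j) \<in> borel_measurable borel"
    unfolding walk_projection_def by simp
qed

section \<open>Rank-one projections and the spectral decomposition of the walk matrix\<close>

lemma hermitian_projection_zero: "hermitian_projection (0 :: complex ^ 'n ^ 'n)"
  by (simp add: hermitian_projection_def cvec_inner_def)

lemma hermitian_projection_ket_bra:
  assumes "cvec_inner w w = 1"
  shows "hermitian_projection (ket_bra w)"
  unfolding hermitian_projection_def
proof (intro conjI allI)
  have *: "ket_bra w *v x = cvec_inner w x *s w" for x
    by (simp add: vec_eq_iff ket_bra_def matrix_vector_mult_def cvec_inner_def sum_distrib_left ac_simps)
  have "(ket_bra w ** ket_bra w) $ i $ j = cvec_inner w w * (w $ i * cnj (w $ j))" for i j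
    by (simp add: ket_bra_def matrix_matrix_mult_def cvec_inner_def sum_distrib_left ac_simps)
  thus "ket_bra w ** ket_bra w = ket_bra w"
    using assms by (simp add: vec_eq_iff ket_bra_def)
  have "cvec_inner (c *s x) y = cnj c * cvec_inner x y" "cvec_inner x (c *s y) = c * cvec_inner x y"
    "cnj (cvec_inner x y) = cvec_inner y x" for c and x y :: "complex ^ 'a"
    by (simp_all add: cvec_inner_def sum_distrib_left ac_simps)
  thus "cvec_inner (ket_bra w *v x) y = cvec_inner x (ket_bra w *v y)" for x y
    by (simp add: *)
qed

text \<open>Orthonormality makes the adjoint of the matrix with columns \<open>wp\<close>,
  \<open>wm\<close> a left inverse. For square matrices it is also a right inverse, which is
  completeness.\<close>

lemma ket_bra_complete:
  fixes wp wm :: "complex ^ 2"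
  assumes "cvec_inner wp wp = 1" "cvec_inner wm wm = 1" "cvec_inner wp wm = 0"
  shows "ket_bra wp + ket_bra wm = mat 1"
proof -
  define W :: "complex ^ 2 ^ 2" where "W = (\<chi> i j. if j = 1 then wp $ i else wm $ i)"
  define V :: "complex ^ 2 ^ 2" where "V = (\<chi> i j. cnj (W $ j $ i))"
  have "cvec_inner wm wp = cnj (cvec_inner wp wm)" by (simp add: cvec_inner_def mult.commute)
  hence "cvec_inner wm wp = 0" using assms(3) by simp
  hence "V ** W = mat 1"
    using assms by (simp add: vec_eq_iff forall_2 V_def W_def matrix_matrix_mult_def cvec_inner_def mat_def)
  hence "W ** V = mat 1" using matrix_left_right_inverse by blast
  moreover have "ket_bra wp + ket_bra wm = W ** V"
    by (simp add: vec_eq_iff ket_bra_def V_def W_def matrix_matrix_mult_def sum_2)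
  ultimately show ?thesis by simp
qed

lemma scaleR_matrix_vector_mult: "(c *\<^sub>R A) *v x = c *\<^sub>R (A *v (x :: complex ^ 'n))"
  by (simp add: vec_eq_iff matrix_vector_mult_def scaleR_sum_right)

lemma matrix_mult_ket_bra: "(A ** ket_bra w) $ i $ j = (A *v w) $ i * cnj (w $ j)"
  by (simp add: ket_bra_def matrix_matrix_mult_def matrix_vector_mult_def sum_distrib_left ac_simps)

context walk_parameters
begin

text \<open>Multiplying the walk matrix by the resolution of the identity gives its spectral
  decomposition with eigenvalues \<open>\<tau> + i s\<close> and \<open>\<tau> - i s\<close>, where
  \<open>s = sqrt (1 - \<tau>^2)\<close> is the sine of \<open>omega\<close>. Subtracting
  \<open>\<tau>\<close> and dividing by \<open>i s\<close> leaves the difference of two projections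
  whose sum is 1.\<close>

lemma walk_projection_eq:
  assumes w: "walk_eigenbasis a1 a2 k wp wm" and \<tau>: "(tau a1 a2 k)\<^sup>2 \<noteq> 1"
  shows "walk_projection a1 a2 k = ket_bra wp" and "ket_bra wm = mat 1 - walk_projection a1 a2 k"
proof -
  let ?\<tau> = "tau a1 a2 k" and ?s = "sqrt (1 - (tau a1 a2 k)\<^sup>2)"
  have complete: "ket_bra wp + ket_bra wm = mat 1"
    using w ket_bra_complete by (simp add: walk_eigenbasis_def)
  have s: "?s \<noteq> 0" using \<tau> by simp
  have "cos (omega a1 a2 k) = ?\<tau>" "sin (omega a1 a2 k) = ?s"
    using tau_bound[of k] by (simp_all add: omega_def sin_arccos_abs cos_arccos_abs)
  hence ep: "exp (\<i> * of_real (omega a1 a2 k)) = of_real ?\<tau> + \<i> * of_real ?s"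
    and em: "exp (- (\<i> * of_real (omega a1 a2 k))) = of_real ?\<tau> - \<i> * of_real ?s"
    by (simp_all add: exp_Euler exp_minus_Euler cos_of_real sin_of_real)
  have eq: "walk a1 a2 k $ i $ j =
      (of_real ?\<tau> + \<i> * of_real ?s) * ket_bra wp $ i $ j + (of_real ?\<tau> - \<i> * of_real ?s) * ket_bra wm $ i $ j" for i j
  proof -
    have "walk a1 a2 k $ i $ j = (walk a1 a2 k ** (ket_bra wp + ket_bra wm)) $ i $ j"
      by (simp add: complete)
    also have "\<dots> = (walk a1 a2 k *v wp) $ i * cnj (wp $ j) + (walk a1 a2 k *v wm) $ i * cnj (wm $ j)"
      by (simp add: matrix_add_ldistrib matrix_mult_ket_bra)
    finally show ?thesis
      using w by (simp add: walk_eigenbasis_def ep em ket_bra_def) (simp add: algebra_simps)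
  qed
  have c: "mat 1 $ i $ j = ket_bra wp $ i $ j + ket_bra wm $ i $ j" for i j
    by (simp flip: complete)
  have "walk_projection a1 a2 k $ i $ j = ket_bra wp $ i $ j" for i j
  proof -
    have "walk a1 a2 k $ i $ j - of_real ?\<tau> * mat 1 $ i $ j =
       (\<i> * of_real ?s) * (ket_bra wp $ i $ j - ket_bra wm $ i $ j)"
      unfolding eq c by (simp add: algebra_simps)
    moreover have "\<i> * complex_of_real ?s \<noteq> 0" using s by simp
    ultimately have "(walk a1 a2 k $ i $ j - of_real ?\<tau> * mat 1 $ i $ j) / (\<i> * of_real ?s) =
        ket_bra wp $ i $ j - ket_bra wm $ i $ j"
      by (metis nonzero_mult_div_cancel_left)
    thus ?thesis using \<tau> by (simp add: walk_projection_def c)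
  qed
  thus "walk_projection a1 a2 k = ket_bra wp" by (simp add: vec_eq_iff)
  thus "ket_bra wm = mat 1 - walk_projection a1 a2 k" by (simp flip: complete)
qed

lemma hermitian_walk_projection:
  assumes w: "walk_eigenbasis a1 a2 k wp wm"
  shows "hermitian_projection (walk_projection a1 a2 k)"
proof (cases "(tau a1 a2 k)\<^sup>2 = 1")
  case True
  hence "walk_projection a1 a2 k = 0" by (simp add: walk_projection_def vec_eq_iff)
  thus ?thesis by (simp add: hermitian_projection_zero)
next
  case False
  thus ?thesis
    using w by (simp add: walk_projection_eq(1)[OF w] hermitian_projection_ket_bra walk_eigenbasis_def)
qed

text \<open>Where the eigenvalues coincide the velocity is 0, so both sides vanish whatever
  eigenbasis is given there.\<close>

lemma velocity_operator_apply:
  assumes w: "walk_eigenbasis a1 a2 k (wp k) (wm k)" and v: "(tau a1 a2 k)\<^sup>2 = 1 \<Longrightarrow> v k = 0"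
  shows "velocity_operator v wp wm f k =
    v k *\<^sub>R (walk_projection a1 a2 k *v f k) - v k *\<^sub>R (f k - walk_projection a1 a2 k *v f k)"
proof (cases "(tau a1 a2 k)\<^sup>2 = 1")
  case True
  thus ?thesis using v by (simp add: velocity_operator_def multiplication_operator_def)
next
  case False
  show ?thesis
    unfolding velocity_operator_def multiplication_operator_def walk_projection_eq(2)[OF w False]
    unfolding walk_projection_eq(1)[OF w False]
    by (simp add: matrix_vector_mult_diff_rdistrib scaleR_matrix_vector_mult)
qed

text \<open>The denominators \<open>a1^2\<close> and \<open>(co a1)^2\<close> are at most 1, so the
  first ellipse lies in the disc of radius \<open>sqrt 2\<close>, hence of radius 2. This bound
  makes the velocity operators bounded.\<close>

lemma velocity_norm: "norm (velocity a1 a2 k) \<le> 2"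
proof -
  let ?v = "velocity a1 a2 k"
  have "ellipse_form (a1\<^sup>2) ((co a1)\<^sup>2) ?v \<le> 1"
    using velocity_in_ellipses[of k] by (simp add: ellipse_eq)
  moreover have "a1\<^sup>2 \<le> 1" "(co a1)\<^sup>2 \<le> 1" "0 < a1\<^sup>2" "0 < (co a1)\<^sup>2"
    using pos squares(1) by (smt (verit) zero_le_power2 zero_less_power2)+
  hence le: "4 * a1\<^sup>2 \<le> 4" "4 * (co a1)\<^sup>2 \<le> 4" "0 < 4 * (4 * a1\<^sup>2)" "0 < 4 * (4 * (co a1)\<^sup>2)" by simp_all
  moreover have "(fst ?v + snd ?v)\<^sup>2 / 4 \<le> (fst ?v + snd ?v)\<^sup>2 / (4 * a1\<^sup>2)"
    using le by (intro divide_left_mono) (simp_all only: zero_le_power2 mult.commute)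
  moreover have "(fst ?v - snd ?v)\<^sup>2 / 4 \<le> (fst ?v - snd ?v)\<^sup>2 / (4 * (co a1)\<^sup>2)"
    using le by (intro divide_left_mono) (simp_all only: zero_le_power2 mult.commute)
  moreover have "(norm ?v)\<^sup>2 = 2 * ((fst ?v + snd ?v)\<^sup>2 / 4 + (fst ?v - snd ?v)\<^sup>2 / 4)"
    by (simp add: norm_prod_def power2_sum power2_diff field_simps)
  ultimately have "(norm ?v)\<^sup>2 \<le> 2\<^sup>2" unfolding ellipse_form_def by simp
  thus ?thesis by (rule power2_le_imp_le) simp
qed

section \<open>Sets of positive measure in the torus with prescribed velocity\<close>

lemma continuous_on_velocity: "continuous_on {k. (tau a1 a2 k)\<^sup>2 \<noteq> 1} (velocity a1 a2)"
proof -
  have "sqrt (1 - (tau a1 a2 k)\<^sup>2) \<noteq> 0" if "(tau a1 a2 k)\<^sup>2 \<noteq> 1" for k using that by simp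
  thus ?thesis
    unfolding velocity_def vel1_def vel2_def tau_def l1_def l2_def
    by (intro continuous_intros) auto
qed

lemma open_tau: "open {k. (tau a1 a2 k)\<^sup>2 \<noteq> 1}"
proof -
  have "continuous_on UNIV (\<lambda>k. (tau a1 a2 k)\<^sup>2)"
    unfolding tau_def l1_def l2_def by (intro continuous_intros)
  thus ?thesis by (intro open_Collect_neq continuous_on_const)
qed

text \<open>Preimages are constructed in the plane, while the measure lives on a fundamental domain.
  Whole periods in both coordinates of \<open>k\<close> shift \<open>l1\<close> and
  \<open>l2\<close> by whole periods.\<close>

lemma periodic:
  fixes k :: "real \<times> real" and m n :: int
  defines "k' \<equiv> (fst k + of_int m * (2 * pi), snd k + of_int n * (2 * pi))"
  shows "tau a1 a2 k' = tau a1 a2 k" "velocity a1 a2 k' = velocity a1 a2 k"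
proof -
  have l: "l1 k' = l1 k + of_int (n + m) * (2 * pi)" "l2 k' = l2 k + of_int (n - m) * (2 * pi)"
    by (simp_all add: l1_def l2_def k'_def algebra_simps)
  have sc: "sin (x + of_int j * (2 * pi)) = sin x" "cos (x + of_int j * (2 * pi)) = cos x" for x :: real and j
    using sin.plus_of_int[of x j] cos.plus_of_int[of x j] by simp_all
  show t: "tau a1 a2 k' = tau a1 a2 k"
    unfolding tau_def l sc ..
  show "velocity a1 a2 k' = velocity a1 a2 k"
    unfolding velocity_def vel1_def vel2_def t unfolding l sc ..
qed

lemma torus_representative:
  fixes k :: "real \<times> real"
  obtains m n :: int where "(fst k + of_int m * (2 * pi), snd k + of_int n * (2 * pi)) \<in> torus"
proof -
  have *: "x + of_int (- \<lfloor>x / (2 * pi)\<rfloor>) * (2 * pi) \<in> {0..<2 * pi}" for x :: real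
  proof -
    have "of_int \<lfloor>x / (2 * pi)\<rfloor> * (2 * pi) \<le> x"
      using mult_right_mono[OF of_int_floor_le[of "x / (2 * pi)"], of "2 * pi"] by simp
    moreover have "x / (2 * pi) < of_int \<lfloor>x / (2 * pi)\<rfloor> + 1" by linarith
    hence "x < (of_int \<lfloor>x / (2 * pi)\<rfloor> + 1) * (2 * pi)"
      by (rule iffD1[OF pos_divide_less_eq, rotated]) simp
    ultimately show ?thesis by (simp add: algebra_simps)
  qed
  show ?thesis
    using *[of "fst k"] *[of "snd k"]
    by (intro that[of "- \<lfloor>fst k / (2 * pi)\<rfloor>" "- \<lfloor>snd k / (2 * pi)\<rfloor>"])
       (simp add: torus_def mem_Times_iff del: of_int_minus)
qed

lemma torus_sets: "torus \<in> sets lebesgue" "emeasure lebesgue torus < \<infinity>"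
proof -
  have "torus \<in> sets borel" unfolding torus_def by (intro borel_Times) auto
  thus "torus \<in> sets lebesgue" by simp
  have "bounded torus" unfolding torus_def by (intro bounded_Times) (auto intro: bounded_subset[OF bounded_closed_interval])
  thus "emeasure lebesgue torus < \<infinity>"
    using bounded_set_imp_lmeasurable[OF _ \<open>torus \<in> sets lebesgue\<close>] by (simp only: fmeasurable_def mem_Collect_eq)
qed

text \<open>The preimage of a ball is open in the plane, but the representative of \<open>k\<close>
  may sit on an edge of the half-open square; a small box next to it still lies in both
  sets.\<close>

lemma positive_measure:
  assumes k: "(tau a1 a2 k)\<^sup>2 \<noteq> 1" "dist (velocity a1 a2 k) c < \<epsilon>"
  shows "\<exists>S\<in>sets torus_measure. 0 < emeasure torus_measure S \<and> emeasure torus_measure S < \<infinity> \<and>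
    (\<forall>k\<in>S. (tau a1 a2 k)\<^sup>2 \<noteq> 1 \<and> dist (velocity a1 a2 k) c \<le> \<epsilon>)"
proof -
  define W where "W = {k. (tau a1 a2 k)\<^sup>2 \<noteq> 1} \<inter> velocity a1 a2 -` ball c \<epsilon>"
  have "open W"
    unfolding W_def by (rule continuous_open_preimage[OF continuous_on_velocity open_tau open_ball])
  define S where "S = W \<inter> torus"
  have "W \<in> sets lebesgue" using \<open>open W\<close> by (intro sets_completionI_sets) simp
  hence S: "S \<in> sets lebesgue" using torus_sets(1) by (simp add: S_def)
  hence S': "S \<in> sets torus_measure" using torus_sets(1) by (simp add: sets_restrict_space_iff S_def)
  have em: "emeasure torus_measure S = emeasure lebesgue S"
    using torus_sets(1) by (simp add: emeasure_restrict_space S_def)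
  have "emeasure lebesgue S \<le> emeasure lebesgue torus"
    using torus_sets(1) by (intro emeasure_mono) (simp_all add: S_def)
  hence fin: "emeasure lebesgue S < \<infinity>" using torus_sets(2) by (rule le_less_trans)
  obtain m n :: int where mn: "(fst k + of_int m * (2 * pi), snd k + of_int n * (2 * pi)) \<in> torus" (is "?k \<in> torus")
    using torus_representative by blast
  have "?k \<in> W" using k by (simp add: W_def periodic dist_commute)
  then obtain r where r: "r > 0" "ball ?k r \<subseteq> W" using \<open>open W\<close> openE by blast
  define u1 where "u1 = fst ?k"
  define u2 where "u2 = snd ?k"
  have u: "?k = (u1, u2)" "0 \<le> u1" "u1 < 2 * pi" "0 \<le> u2" "u2 < 2 * pi"
    using mn by (simp_all add: torus_def u1_def u2_def)
  \<comment> \<open>The bound \<open>r / 2\<close> keeps the box inside the ball, the other two stop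
    it at the upper edges. It extends only upwards from the representative, so a point on a lower
    edge causes no trouble.\<close>
  define d where "d = min (r / 2) (min (2 * pi - u1) (2 * pi - u2))"
  have d: "d > 0" "d \<le> r / 2" "d \<le> 2 * pi - u1" "d \<le> 2 * pi - u2"
    using r u by (simp_all add: d_def min_def)
  let ?B = "{u1<..<u1 + d} \<times> {u2<..<u2 + d}"
  have "?B \<subseteq> S"
  proof
    fix z assume z: "z \<in> ?B"
    have "dist (u1, u2) z \<le> \<bar>fst z - u1\<bar> + \<bar>snd z - u2\<bar>"
      unfolding dist_prod_def using sqrt_sum_squares_le_sum_abs[of "dist u1 (fst z)" "dist u2 (snd z)"]
      by (simp add: dist_real_def abs_minus_commute)
    also have "\<dots> < r" using z d(2) by auto
    finally have "z \<in> W" using r(2) u(1) by auto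
    moreover have "z \<in> torus" using z u d by (auto simp: torus_def)
    ultimately show "z \<in> S" by (simp add: S_def)
  qed
  moreover have "open ?B" "?B \<noteq> {}"
    using d(1) by (auto intro: open_Times)
  ultimately have "\<not> negligible S"
    using open_not_negligible negligible_subset by blast
  hence "emeasure lebesgue S \<noteq> 0"
    using S by (simp add: negligible_iff_null_sets null_sets_def)
  hence "0 < emeasure torus_measure S" by (simp add: em zero_less_iff_neq_zero)
  moreover have "\<forall>k\<in>S. (tau a1 a2 k)\<^sup>2 \<noteq> 1 \<and> dist (velocity a1 a2 k) c \<le> \<epsilon>"
    by (auto simp: S_def W_def dist_commute)
  ultimately show ?thesis using fin em by (intro bexI[OF _ S']) auto
qed

text \<open>The upper bound involves both \<open>v\<close> and \<open>- v\<close>, the lower bound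
  only \<open>v\<close>, because the image of \<open>v\<close> alone is already dense in the
  symmetric set \<open>?C\<close>.\<close>

lemma joint_spectrum_velocity:
  assumes w: "\<And>k. k \<in> torus \<Longrightarrow> walk_eigenbasis a1 a2 k (wp k) (wm k)"
  shows "joint_spectrum torus_measure
      (velocity_operator (vel1 a1 a2) wp wm) (velocity_operator (vel2 a1 a2) wp wm) =
    ellipse (a1\<^sup>2) ((co a1)\<^sup>2) \<inter> ellipse (a2\<^sup>2) ((co a2)\<^sup>2)" (is "?\<Sigma> = ?C")
proof -
  have sp: "space torus_measure = torus" by simp
  interpret projection_field torus_measure "walk_projection a1 a2"
    by unfold_locales (use borel_measurable_walk_projection hermitian_walk_projection[OF w] in auto)
  note vm = borel_measurable_torus[OF borel_measurable_velocity, of a1 a2]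
  have T: "velocity_operator (vel1 a1 a2) wp wm f k =
        fst (velocity a1 a2 k) *\<^sub>R (walk_projection a1 a2 k *v f k) - fst (velocity a1 a2 k) *\<^sub>R (f k - walk_projection a1 a2 k *v f k)"
      "velocity_operator (vel2 a1 a2) wp wm f k =
        snd (velocity a1 a2 k) *\<^sub>R (walk_projection a1 a2 k *v f k) - snd (velocity a1 a2 k) *\<^sub>R (f k - walk_projection a1 a2 k *v f k)"
    if "k \<in> space torus_measure" for f k
  proof -
    have "k \<in> torus" using that by simp
    note ap = velocity_operator_apply[where wp = wp and wm = wm, OF w[OF this]]
    show "velocity_operator (vel1 a1 a2) wp wm f k =
        fst (velocity a1 a2 k) *\<^sub>R (walk_projection a1 a2 k *v f k) - fst (velocity a1 a2 k) *\<^sub>R (f k - walk_projection a1 a2 k *v f k)"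
      by (subst ap) (simp_all add: velocity_def vel1_def)
    show "velocity_operator (vel2 a1 a2) wp wm f k =
        snd (velocity a1 a2 k) *\<^sub>R (walk_projection a1 a2 k *v f k) - snd (velocity a1 a2 k) *\<^sub>R (f k - walk_projection a1 a2 k *v f k)"
      by (subst ap) (simp_all add: velocity_def vel2_def)
  qed
  show ?thesis
  proof
    show "?\<Sigma> \<subseteq> ?C"
    proof (rule joint_spectrum_subset[where v = "velocity a1 a2", OF vm velocity_norm])
      show "closed ?C" by (intro closed_Int closed_ellipse)
      show "velocity a1 a2 k \<in> ?C \<and> - velocity a1 a2 k \<in> ?C" for k
        using velocity_in_ellipses[of k] ellipse_uminus by blast
    qed (fact T)+
    show "?C \<subseteq> ?\<Sigma>"
    proof
      fix c assume "c \<in> ?C"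
      hence cl: "c \<in> closure (velocity a1 a2 ` {k. (tau a1 a2 k)\<^sup>2 \<noteq> 1})"
        using ellipses_subset_closure by blast
      show "c \<in> ?\<Sigma>"
      proof (rule mem_joint_spectrum[where v = "velocity a1 a2", OF vm velocity_norm])
        fix \<epsilon> :: real assume "\<epsilon> > 0"
        then obtain k where "(tau a1 a2 k)\<^sup>2 \<noteq> 1" "dist (velocity a1 a2 k) c < \<epsilon>"
          using cl unfolding closure_approachable by blast
        from positive_measure[OF this] obtain S where S: "S \<in> sets torus_measure" "0 < emeasure torus_measure S"
          "emeasure torus_measure S < \<infinity>" "\<And>k. k \<in> S \<Longrightarrow> (tau a1 a2 k)\<^sup>2 \<noteq> 1"
          "\<And>k. k \<in> S \<Longrightarrow> dist (velocity a1 a2 k) c \<le> \<epsilon>" by blast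
        \<comment> \<open>The projection is \<open>ket_bra\<close> of a unit vector, so its diagonal
          entries sum to 1.\<close>
        have "walk_projection a1 a2 k \<noteq> 0" if "k \<in> S" for k
        proof
          assume 0: "walk_projection a1 a2 k = 0"
          have "k \<in> torus" using that S(1) sets.sets_into_space sp by blast
          note wk = w[OF this]
          have "ket_bra (wp k) = 0" using walk_projection_eq(1)[OF wk S(4)[OF that]] 0 by simp
          hence "wp k $ i * cnj (wp k $ i) = 0" for i by (simp add: ket_bra_def vec_eq_iff)
          hence "cvec_inner (wp k) (wp k) = 0" by (simp add: cvec_inner_def)
          thus False using wk by (simp add: walk_eigenbasis_def)
        qed
        thus "\<exists>S\<in>sets torus_measure. 0 < emeasure torus_measure S \<and> emeasure torus_measure S < \<infinity> \<and>
            (\<forall>k\<in>S. walk_projection a1 a2 k \<noteq> 0 \<and> dist (velocity a1 a2 k) c \<le> \<epsilon>)"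
          using S by blast
      qed (fact T)+
    qed
  qed
qed

end

theorem theorem15:
  fixes a1 a2 a b :: real
    and wp wm :: "real \<times> real \<Rightarrow> complex ^ 2"
  assumes "a1 \<in> {0..1}" and "a2 \<in> {0..1}"
    and "a = a1 * a2" and "b = co a1 * co a2"
    and "\<And>k. k \<in> torus \<Longrightarrow> walk_eigenbasis a1 a2 k (wp k) (wm k)"
  defines "\<Sigma> \<equiv> joint_spectrum torus_measure
      (velocity_operator (vel1 a1 a2) wp wm) (velocity_operator (vel2 a1 a2) wp wm)"
  shows "(a > 0 \<and> b > 0 \<and> a + b < 1 \<longrightarrow>
            \<Sigma> = ellipse (a1\<^sup>2) ((co a1)\<^sup>2) \<inter> ellipse (a2\<^sup>2) ((co a2)\<^sup>2)) \<and>
         (a > 0 \<and> b > 0 \<and> a + b = 1 \<longrightarrow> \<Sigma> = ellipse a b)"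
proof (intro conjI impI; elim conjE)
  assume "a > 0" "b > 0"
  then interpret walk_parameters a1 a2 a b
    using assms(1-4) by unfold_locales
  note \<Sigma> = joint_spectrum_velocity[OF assms(5), folded \<Sigma>_def]
  show "\<Sigma> = ellipse (a1\<^sup>2) ((co a1)\<^sup>2) \<inter> ellipse (a2\<^sup>2) ((co a2)\<^sup>2)" by (rule \<Sigma>)
  \<comment> \<open>For equal coins \<open>a = a1^2\<close> and \<open>b = (co a1)^2\<close>, so
    both ellipses are the ellipse for \<open>a\<close>, \<open>b\<close>.\<close>
  assume "a + b = 1"
  hence "a1 = a2" using sum_lt_1_iff by auto
  thus "\<Sigma> = ellipse a b" using \<Sigma> by (simp add: a_eq b_eq power2_eq_square)
qed

end
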